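(* Let $A$ be the generator of a $C_0$-semigroup on a Banach space $\mathbb{X}$ that has an exponential dichotomy. Then the $C_0$-semigroup generated by an operator $B$ in $\mathbb{X}$ also has an exponential dichotomy, provided that the Yosida distance $d_Y(A,B)$ is sufficiently small; that is, there exists $\delta>0$ such that every operator $B$ that generates a $C_0$-semigroup on $\mathbb{X}$ and satisfies $d_Y(A,B)<\delta$ generates a $C_0$-semigroup having an exponential dichotomy.
   Context: Yosida approximation and Yosida distance. For a (possibly unbounded) linear operator $A$ in a Banach space $\mathbb{X}$ with resolvent set $\rho(A)\supset[\omega,\infty)$ for some real $\omega$, put $R(\mu,A)=(\mu I-A)^{-1}$ and let $A_\mu:=\mu^2R(\mu,A)-\mu I$ for sufficiently large $\mu$ (the Yosida approximation). If $A$ and $B$ are linear operators with $\rho(A)\supset[\omega,\infty)$ and $\rho(B)\supset[\omega,\infty)$, their Yosida distance is $d_Y(A,B):=\limsup_{\mu\to+\infty}\|A_\mu-B_\mu\|$ (operator norm; the value $+\infty$ is possible). No inclusion between $D(A)$ and $D(B)$ is assumed. Exponential dichotomy. A linear semigroup $(T(t))_{t\ge 0}$ on $\mathbb{X}$ has an exponential dichotomy (is hyperbolic) if there exist a bounded projection $P$ on $\mathbb{X}$ and positive constants $N,\beta$ such that: (1) $T(t)P=PT(t)$ for all $t\ge 0$; (2) for all $t\ge 0$, $T(t)|_{\mathrm{Ker}(P)}$ is an isomorphism from $\mathrm{Ker}(P)$ onto $\mathrm{Ker}(P)$, whose inverse is denoted $T(-t)$; (3) $\|T(t)x\|\le Ne^{-\beta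 t}\|x\|$ for all $t\ge 0$, $x\in\mathrm{Im}(P)$, and $\|T(-t)x\|\le Ne^{-\beta t}\|x\|$ for all $t\ge 0$, $x\in\mathrm{Ker}(P)$. *)

theory Defs
  imports "HOL-Analysis.Analysis"
begin

text \<open>
  A Banach space over a scalar field \<open>'k\<close>, real or complex: \<open>smul\<close> extends the real scalar
  multiplication of the library. By the theorem of Mazur the instances of
  \<open>real_normed_field\<close> are copies of the real and of the complex field only, and for the
  real field \<open>smul\<close> is \<open>scaleR\<close>.
\<close>

locale banach_over = vector_space smul
  for smul :: "'k::real_normed_field \<Rightarrow> 'a::banach \<Rightarrow> 'a" +
  assumes smul_of_real: "smul (of_real r) x = r *\<^sub>R x"
    and norm_smul: "norm (smul c x) = norm c * norm x"

definition bounded_operator ::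
  "('k::real_normed_field \<Rightarrow> 'a::banach \<Rightarrow> 'a) \<Rightarrow> ('a \<Rightarrow> 'a) \<Rightarrow> bool" where
  "bounded_operator smul F \<longleftrightarrow> Vector_Spaces.linear smul smul F \<and> bounded_linear F"

text \<open>Semigroups are functions on the reals of which only the values at \<open>t \<ge> 0\<close> matter.\<close>

definition C0_semigroup ::
  "('k::real_normed_field \<Rightarrow> 'a::banach \<Rightarrow> 'a) \<Rightarrow> (real \<Rightarrow> 'a \<Rightarrow> 'a) \<Rightarrow> bool" where
  "C0_semigroup smul T \<longleftrightarrow>
     (\<forall>t\<ge>0. bounded_operator smul (T t)) \<and>
     (\<forall>x. T 0 x = x) \<and>
     (\<forall>s\<ge>0. \<forall>t\<ge>0. \<forall>x. T (s + t) x = T s (T t x)) \<and>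
     (\<forall>x. ((\<lambda>t. T t x) \<longlongrightarrow> x) (at_right 0))"

text \<open>
  An unbounded operator is given by its domain \<open>D\<close> and a total function \<open>A\<close> whose values
  outside \<open>D\<close> are irrelevant. The domain of the generator is exactly the set of points at
  which the difference quotient converges; when \<open>T\<close> is a \<open>C0\<close>-semigroup, this makes \<open>D\<close> a
  linear subspace and \<open>A\<close> linear on \<open>D\<close>.
\<close>

definition generator_of :: "(real \<Rightarrow> 'a::banach \<Rightarrow> 'a) \<Rightarrow> 'a set \<Rightarrow> ('a \<Rightarrow> 'a) \<Rightarrow> bool" where
  "generator_of T D A \<longleftrightarrow>
     D = {x. \<exists>y. ((\<lambda>t. (T t x - x) /\<^sub>R t) \<longlongrightarrow> y) (at_right 0)} \<and>
     (\<forall>x\<in>D. ((\<lambda>t. (T t x - x) /\<^sub>R t) \<longlongrightarrow> A x) (at_right 0))"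

text \<open>
  The inverse of \<open>\<mu>I - A : D \<rightarrow> X\<close>, meaningful when \<open>\<mu>\<close> lies in the resolvent set. If \<open>A\<close>
  generates a \<open>C0\<close>-semigroup, this is the case for all sufficiently large real \<open>\<mu>\<close>.
\<close>

definition resolvent :: "'a::banach set \<Rightarrow> ('a \<Rightarrow> 'a) \<Rightarrow> real \<Rightarrow> 'a \<Rightarrow> 'a" where
  "resolvent D A \<mu> = inv_into D (\<lambda>x. \<mu> *\<^sub>R x - A x)"

definition yosida_approx :: "'a::banach set \<Rightarrow> ('a \<Rightarrow> 'a) \<Rightarrow> real \<Rightarrow> 'a \<Rightarrow> 'a" where
  "yosida_approx D A \<mu> x = \<mu>\<^sup>2 *\<^sub>R resolvent D A \<mu> x - \<mu> *\<^sub>R x"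

text \<open>
  Only large \<open>\<mu>\<close> influence the upper limit. For generators of \<open>C0\<close>-semigroups the
  difference of the Yosida approximations is then a bounded operator, so that \<open>onorm\<close>
  is its operator norm.
\<close>

definition yosida_distance ::
  "'a::banach set \<Rightarrow> ('a \<Rightarrow> 'a) \<Rightarrow> 'a set \<Rightarrow> ('a \<Rightarrow> 'a) \<Rightarrow> ereal" where
  "yosida_distance D A E B =
     Limsup at_top (\<lambda>\<mu>. ereal (onorm (\<lambda>x. yosida_approx D A \<mu> x - yosida_approx E B \<mu> x)))"

text \<open>
  \<open>inv_into Ker (T t)\<close> is the operator \<open>T(-t)\<close> on \<open>Ker\<close>, the kernel of the projection; its
  boundedness, which turns the linear bijection \<open>T t\<close> of \<open>Ker\<close> into an isomorphism of
  normed spaces, is contained in the last estimate.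
\<close>

definition exponential_dichotomy ::
  "('k::real_normed_field \<Rightarrow> 'a::banach \<Rightarrow> 'a) \<Rightarrow> (real \<Rightarrow> 'a \<Rightarrow> 'a) \<Rightarrow> bool" where
  "exponential_dichotomy smul T \<longleftrightarrow>
     (\<exists>P N \<beta>. bounded_operator smul P \<and> (\<forall>x. P (P x) = P x) \<and> 0 < N \<and> 0 < \<beta> \<and>
       (let Ker = {x. P x = 0} in
         (\<forall>t\<ge>0. \<forall>x. T t (P x) = P (T t x)) \<and>
         (\<forall>t\<ge>0. bij_betw (T t) Ker Ker) \<and>
         (\<forall>t\<ge>0. \<forall>x\<in>range P. norm (T t x) \<le> N * exp (- \<beta> * t) * norm x) \<and>
         (\<forall>t\<ge>0. \<forall>x\<in>Ker. norm (inv_into Ker (T t) x) \<le> N * exp (- \<beta> * t) * norm x)))"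

end

theory Submission
  imports Defs
begin

text \<open>
  A small Yosida distance makes the semigroups close in operator norm at each fixed time, and
  hyperbolicity of a single operator \<open>T \<tau>\<close> survives small perturbations.

  \<^bold>\<open>Closeness.\<close> The Yosida approximation of \<open>A\<close> at \<open>\<mu>\<close> is \<open>\<mu>\<close> times the difference of the implicit Euler
  step \<open>J = \<mu> R(\<mu>, A)\<close> and the identity. A Yosida distance below \<open>\<delta>\<close> therefore says that the Euler steps of
  \<open>A\<close> and \<open>B\<close> differ by at most \<open>\<delta> / \<mu>\<close> for large \<open>\<mu>\<close>. The exponential formula (\<open>exponential_formula\<close>)
  recovers \<open>T t\<close> as the limit of \<open>J ^^ n\<close> for \<open>\<mu> = n / t\<close>, and \<open>n\<close> errors of size \<open>\<delta> t / n\<close>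
  add up to a multiple of \<open>\<delta>\<close> (\<open>semigroup_distance_le\<close>). The constants depend on the growth bound of \<open>T\<close>
  only. What this needs from the generation theory is that the resolvent of a
  generator is the Laplace transform of its semigroup (\<open>resolvent_eq_laplace\<close>), together with the
  Hille-Yosida bounds on its powers (\<open>euler_step_funpow_bound\<close>).

  \<^bold>\<open>Perturbation.\<close> Hyperbolicity of an operator \<open>L\<close> is expressed by the two-sided system
  \<open>u n = L (u (n - 1)) + f n\<close> having a unique bounded solution for an impulse \<open>f\<close>. For \<open>L = T \<tau>\<close> with
  large \<open>\<tau>\<close>, the stable part is solved forward and the unstable part backward in time,
  which turns the system into a fixed point equation with small coefficients. Such an equation remains one
  when \<open>L\<close> is replaced by a nearby operator (\<open>has_decaying_responses_perturbation\<close>), and smallness of the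
  coefficients forces solutions to decay geometrically away from the impulse. Conversely the value at time
  \<open>0\<close> of the response to \<open>x\<close> is a projection of \<open>x\<close>, and by uniqueness of responses it commutes with the whole
  semigroup; it is the projection of the dichotomy (\<open>exponential_dichotomy_of_responses\<close>). No spectral
  theory is involved, and real and complex scalars are treated alike.
\<close>

section \<open>The uniform boundedness principle\<close>

text \<open>
  The sets of points at which all operators are bounded by \<open>k\<close> are closed and cover the space, so by
  Baire one of them contains a ball. Linearity carries the bound from that ball to the unit ball.
\<close>

theorem uniform_boundedness_principle:
  fixes F :: "nat \<Rightarrow> 'a::banach \<Rightarrow> 'b::real_normed_vector"
  assumes lin: "\<And>n. bounded_linear (F n)"
    and pointwise: "\<And>x. bounded (range (\<lambda>n. F n x))"
  obtains K where "\<And>n x. norm (F n x) \<le> K * norm x"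
proof -
  define E where "E k = (\<Inter>n. {x. norm (F n x) \<le> real k})" for k
  have closed: "closed (E k)" for k
    unfolding E_def
    by (intro closed_INT ballI closed_Collect_le continuous_intros
        bounded_linear.continuous_on[OF lin])
  have cover: "(\<Union>k. E k) = UNIV"
  proof -
    have "\<exists>k. x \<in> E k" for x
    proof -
      obtain B where "\<And>n. norm (F n x) \<le> B"
        using pointwise[of x] by (auto simp: bounded_iff)
      moreover obtain k where "B \<le> real k" using real_arch_simple by blast
      ultimately show ?thesis
        unfolding E_def by (auto intro!: exI[of _ k] intro: order_trans)
    qed
    then show ?thesis by auto
  qed
  have "\<exists>k. interior (E k) \<noteq> {}"
  proof (rule ccontr)
    assume none: "\<not> (\<exists>k. interior (E k) \<noteq> {})"
    have "euclidean interior_of \<Union>(range E) = {}"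
      by (rule Baire_category_alt)
        (use none closed in \<open>auto simp: completely_metrizable_space_euclidean\<close>)
    then show False using cover by simp
  qed
  then obtain k a where "a \<in> interior (E k)" by blast
  then obtain r where r: "r > 0" "cball a r \<subseteq> E k"
    by (meson mem_interior_cball)
  have "norm (F n x) \<le> (2 * real k / r) * norm x" for n x
  proof (cases "x = 0")
    case True
    then show ?thesis using linear_0[OF bounded_linear.linear[OF lin[of n]]] by simp
  next
    case False
    interpret bounded_linear "F n" by (rule lin)
    \<comment> \<open>The rescaled vector is the difference of two points of the ball around \<open>a\<close>.\<close>
    let ?y = "(r / norm x) *\<^sub>R x"
    have "a \<in> E k" "a + ?y \<in> E k"
      using r False by (auto intro!: subsetD[OF r(2)] simp: dist_norm)
    then have "norm (F n (a + ?y)) \<le> real k" "norm (F n a) \<le> real k"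
      by (auto simp: E_def)
    then have "norm (F n ?y) \<le> 2 * real k"
      using norm_triangle_ineq4[of "F n (a + ?y)" "F n a"] by (simp add: add)
    then show ?thesis
      using r False by (simp add: scaleR field_simps)
  qed
  then show ?thesis by (rule that)
qed

section \<open>Strongly continuous semigroups and their growth\<close>

locale strongly_continuous_semigroup =
  fixes T :: "real \<Rightarrow> 'a::banach \<Rightarrow> 'a"
  assumes bounded_linear_op: "t \<ge> 0 \<Longrightarrow> bounded_linear (T t)"
    and at_zero: "T 0 x = x"
    and semigroup: "s \<ge> 0 \<Longrightarrow> t \<ge> 0 \<Longrightarrow> T (s + t) x = T s (T t x)"
    and continuous_at_zero: "((\<lambda>t. T t x) \<longlongrightarrow> x) (at_right 0)"
begin

lemma commute: "s \<ge> 0 \<Longrightarrow> t \<ge> 0 \<Longrightarrow> T s (T t x) = T t (T s x)"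
  by (metis add.commute semigroup)

lemma power_eq: "t \<ge> 0 \<Longrightarrow> (T t ^^ n) x = T (real n * t) x"
  by (induction n) (simp_all add: at_zero semigroup algebra_simps)

text \<open>
  Right continuity at the origin also covers a family of times that may take the value \<open>0\<close>, since
  \<open>T 0\<close> is the identity.
\<close>

lemma tendsto_orbit_at_zero:
  assumes "(f \<longlongrightarrow> 0) F" "\<forall>\<^sub>F i in F. f i \<ge> 0"
  shows "((\<lambda>i. T (f i) x) \<longlongrightarrow> x) F"
proof -
  have "continuous (at 0 within {0..}) (\<lambda>t. T t x)"
    using continuous_at_zero[of x]
    by (simp add: continuous_within at_within_Ici_at_right at_zero)
  then show ?thesis
    using continuous_within_tendsto_compose[of 0 "{0..}" "\<lambda>t. T t x" f F] assms
    by (simp add: at_zero)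
qed

text \<open>
  Operators of unbounded norm at times shrinking to \<open>0\<close> would contradict uniform boundedness, since
  each of their orbits converges.
\<close>

lemma locally_bounded:
  obtains \<eta> K where "\<eta> > 0" "\<And>t x. 0 \<le> t \<Longrightarrow> t \<le> \<eta> \<Longrightarrow> norm (T t x) \<le> K * norm x"
proof (rule ccontr)
  assume "\<not> thesis"
  then have neg: "\<not> (\<forall>t x. 0 \<le> t \<longrightarrow> t \<le> \<eta> \<longrightarrow> norm (T t x) \<le> K * norm x)" if "\<eta> > 0" for \<eta> K
    using that \<open>\<And>\<eta> K. \<lbrakk>0 < \<eta>; \<And>t x. \<lbrakk>0 \<le> t; t \<le> \<eta>\<rbrakk> \<Longrightarrow> norm (T t x) \<le> K * norm x\<rbrakk> \<Longrightarrow> thesis\<close>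
    by blast
  have "\<forall>n. \<exists>t x. 0 \<le> t \<and> t \<le> inverse (real (Suc n)) \<and> norm (T t x) > real n * norm x"
    using neg[of "inverse (real (Suc _))" "real _"] by (force simp: not_le)
  then obtain t x where tx: "\<And>n. 0 \<le> t n" "\<And>n. t n \<le> inverse (real (Suc n))"
      "\<And>n. norm (T (t n) (x n)) > real n * norm (x n)"
    by metis
  have "t \<longlonglongrightarrow> 0"
    using tx by (intro tendsto_sandwich[OF _ _ tendsto_const LIMSEQ_inverse_real_of_nat]) auto
  then have "(\<lambda>n. T (t n) y) \<longlonglongrightarrow> y" for y
    by (rule tendsto_orbit_at_zero) (use tx in auto)
  then have "bounded (range (\<lambda>n. T (t n) y))" for y
    using convergent_imp_bounded by blast
  then obtain K where K: "\<And>n x. norm (T (t n) x) \<le> K * norm x"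
    using uniform_boundedness_principle[of "\<lambda>n. T (t n)"] bounded_linear_op tx(1) by metis
  obtain n where "K \<le> real n" using real_arch_simple by blast
  then have "norm (T (t n) (x n)) \<le> real n * norm (x n)"
    using K[of n "x n"] by (meson mult_right_mono norm_ge_zero order_trans)
  with tx(3)[of n] show False by simp
qed

text \<open>
  A time \<open>t\<close> is split into at most \<open>t / \<eta>\<close> steps of length \<open>\<eta>\<close> and a remainder, and each factor is
  bounded by the local bound \<open>K\<close>. This gives the growth rate \<open>ln K / \<eta>\<close>.
\<close>

lemma growth_bound_exists:
  obtains M \<omega> where "M \<ge> 1" "\<omega> \<ge> 0" "\<And>t x. t \<ge> 0 \<Longrightarrow> norm (T t x) \<le> M * exp (\<omega> * t) * norm x"
proof -
  obtain \<eta> K0 where \<eta>: "\<eta> > 0" and K0: "\<And>t x. 0 \<le> t \<Longrightarrow> t \<le> \<eta> \<Longrightarrow> norm (T t x) \<le> K0 * norm x"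
    using locally_bounded by blast
  define K where "K = max 1 K0"
  have K1: "K \<ge> 1" by (simp add: K_def)
  have K: "norm (T t x) \<le> K * norm x" if "0 \<le> t" "t \<le> \<eta>" for t x
    using K0[OF that, of x] by (rule order_trans) (auto simp: K_def intro: mult_right_mono)
  have step: "norm (T (real n * \<eta> + s) x) \<le> K ^ n * K * norm x" if "0 \<le> s" "s \<le> \<eta>" for n s x
  proof (induction n)
    case 0
    then show ?case using K that by simp
  next
    case (Suc n)
    have "T (real (Suc n) * \<eta> + s) x = T \<eta> (T (real n * \<eta> + s) x)"
      using \<eta> that semigroup[of \<eta> "real n * \<eta> + s" x] by (simp add: algebra_simps)
    then have "norm (T (real (Suc n) * \<eta> + s) x) \<le> K * norm (T (real n * \<eta> + s) x)"
      using K[of \<eta>] \<eta> by simp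
    also have "\<dots> \<le> K * (K ^ n * K * norm x)"
      using Suc K1 by (intro mult_left_mono) auto
    finally show ?case by (simp add: algebra_simps)
  qed
  define \<omega> where "\<omega> = ln K / \<eta>"
  have \<omega>: "\<omega> \<ge> 0" using K1 \<eta> by (simp add: \<omega>_def)
  have "norm (T t x) \<le> K * exp (\<omega> * t) * norm x" if "t \<ge> 0" for t x
  proof -
    define n where "n = nat \<lfloor>t / \<eta>\<rfloor>"
    have n: "real n * \<eta> \<le> t" "t \<le> real n * \<eta> + \<eta>"
    proof -
      have rn: "real n = of_int \<lfloor>t / \<eta>\<rfloor>" using that \<eta> by (simp add: n_def)
      have "real n \<le> t / \<eta>" "t / \<eta> \<le> real n + 1" unfolding rn by linarith+
      then show "real n * \<eta> \<le> t" "t \<le> real n * \<eta> + \<eta>" using \<eta> by (auto simp: field_simps)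
    qed
    have "norm (T t x) \<le> K ^ n * K * norm x"
      using step[of "t - real n * \<eta>" n x] n by simp
    also have "K ^ n = exp (real n * ln K)"
      using K1 by (simp add: exp_of_nat_mult)
    also have "real n * ln K = \<omega> * (real n * \<eta>)"
      using \<eta> by (simp add: \<omega>_def)
    also have "exp (\<omega> * (real n * \<eta>)) * K * norm x \<le> exp (\<omega> * t) * K * norm x"
      using n \<omega> K1 by (intro mult_right_mono) (auto intro: mult_left_mono)
    finally show ?thesis by (simp add: algebra_simps)
  qed
  then show ?thesis using that K1 \<omega> by blast
qed

end

section \<open>The resolvent as a Laplace transform\<close>

locale growth_bounded_semigroup = strongly_continuous_semigroup T
  for T :: "real \<Rightarrow> 'a::banach \<Rightarrow> 'a" +
  fixes M \<omega> :: real
  assumes M_ge_1: "M \<ge> 1" and \<omega>_nonneg: "\<omega> \<ge> 0"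
    and growth: "t \<ge> 0 \<Longrightarrow> norm (T t x) \<le> M * exp (\<omega> * t) * norm x"
begin

lemma continuous_orbit: "continuous_on {0..} (\<lambda>t. T t x)"
  unfolding continuous_on_def
proof
  fix t :: real assume t: "t \<in> {0..}"
  have diff: "norm (T s x - T t x) \<le> M * exp (\<omega> * t) * norm (T \<bar>s - t\<bar> x - x)" if "s \<ge> 0" for s
  proof -
    have main: "norm (T (u + v) x - T u x) \<le> M * exp (\<omega> * t) * norm (T v x - x)"
      if "0 \<le> u" "u \<le> t" "0 \<le> v" for u v
    proof -
      interpret bounded_linear "T u" by (rule bounded_linear_op) fact
      have "norm (T (u + v) x - T u x) \<le> M * exp (\<omega> * u) * norm (T v x - x)"
        using growth[of u "T v x - x"] that by (simp add: semigroup diff)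
      also have "\<dots> \<le> M * exp (\<omega> * t) * norm (T v x - x)"
        using that M_ge_1 \<omega>_nonneg by (intro mult_right_mono) (auto intro: mult_left_mono)
      finally show ?thesis .
    qed
    show ?thesis
    proof (cases "s \<ge> t")
      case True
      then show ?thesis using main[of t "s - t"] t by simp
    next
      case False
      then show ?thesis using main[of s "t - s"] t that by (simp add: norm_minus_commute)
    qed
  qed
  have "((\<lambda>s. T \<bar>s - t\<bar> x) \<longlongrightarrow> x) (at t within {0..})"
    by (rule tendsto_orbit_at_zero) (auto intro!: tendsto_eq_intros)
  then have "((\<lambda>s. M * exp (\<omega> * t) * norm (T \<bar>s - t\<bar> x - x)) \<longlongrightarrow> 0) (at t within {0..})"
    by (auto intro!: tendsto_eq_intros)
  moreover have "\<forall>\<^sub>F s in at t within {0..}. norm (T s x - T t x) \<le> M * exp (\<omega> * t) * norm (T \<bar>s - t\<bar> x - x)"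
    unfolding eventually_at_filter using diff by auto
  ultimately have "((\<lambda>s. T s x - T t x) \<longlongrightarrow> 0) (at t within {0..})"
    by (rule Lim_null_comparison[rotated])
  then show "((\<lambda>s. T s x) \<longlongrightarrow> T t x) (at t within {0..})"
    using LIM_zero_iff by blast
qed

text \<open>
  The improper integral that gives the resolvent is formed as a limit of integrals of continuous functions
  over compact intervals, which exist in every Banach space.
\<close>

definition truncated_laplace :: "real \<Rightarrow> real \<Rightarrow> 'a \<Rightarrow> 'a" where
  "truncated_laplace \<mu> \<tau> x = integral {0..\<tau>} (\<lambda>t. exp (- \<mu> * t) *\<^sub>R T t x)"

definition laplace :: "real \<Rightarrow> 'a \<Rightarrow> 'a" where
  "laplace \<mu> x = lim (\<lambda>n. truncated_laplace \<mu> (real n) x)"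

lemma continuous_weighted: "continuous_on {0..} (\<lambda>t. exp (- \<mu> * t) *\<^sub>R T t x)"
  by (intro continuous_intros continuous_orbit)

lemma integrable_weighted: "0 \<le> a \<Longrightarrow> (\<lambda>t. exp (- \<mu> * t) *\<^sub>R T t x) integrable_on {a..b}"
  by (rule integrable_continuous_interval) (rule continuous_on_subset[OF continuous_weighted], auto)

lemma truncated_laplace_diff:
  assumes "0 \<le> a" "a \<le> b"
  shows "truncated_laplace \<mu> b x - truncated_laplace \<mu> a x
    = integral {a..b} (\<lambda>t. exp (- \<mu> * t) *\<^sub>R T t x)"
  using Henstock_Kurzweil_Integration.integral_combine[OF assms integrable_weighted[of 0 \<mu> x b]]
  by (simp add: truncated_laplace_def algebra_simps)

text \<open>
  The bound depends on the orbit of \<open>x\<close> through \<open>K\<close> alone. Taking for \<open>K\<close> something better than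
  \<open>M * norm x\<close> is what later gives power bounds of the resolvent without a factor \<open>M\<close> for every power.
\<close>

lemma truncated_laplace_increment:
  assumes orbit: "\<And>t. t \<ge> 0 \<Longrightarrow> norm (T t x) \<le> K * exp (\<omega> * t)"
    and "\<omega> < \<mu>" "0 \<le> a" "a \<le> b"
  shows "norm (truncated_laplace \<mu> b x - truncated_laplace \<mu> a x) \<le> K / (\<mu> - \<omega>) * exp (- (\<mu> - \<omega>) * a)"
proof -
  define \<nu> where "\<nu> = \<mu> - \<omega>"
  have \<nu>: "\<nu> > 0" using assms by (simp add: \<nu>_def)
  define g where "g t = K * exp (- \<nu> * t)" for t
  have int: "(g has_integral (- K / \<nu> * exp (- \<nu> * b)) - (- K / \<nu> * exp (- \<nu> * a))) {a..b}"
    unfolding g_def using \<nu> assms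
    by (intro fundamental_theorem_of_calculus)
       (auto simp flip: has_real_derivative_iff_has_vector_derivative intro!: derivative_eq_intros)
  have K: "K \<ge> 0" using order_trans[OF norm_ge_zero orbit[of 0]] by simp
  have "norm (integral {a..b} (\<lambda>t. exp (- \<mu> * t) *\<^sub>R T t x)) \<le> integral {a..b} g"
  proof (rule integral_norm_bound_integral)
    show "(\<lambda>t. exp (- \<mu> * t) *\<^sub>R T t x) integrable_on {a..b}"
      using assms by (intro integrable_weighted)
    show "g integrable_on {a..b}" using int by blast
    fix t assume "t \<in> {a..b}"
    then have "norm (exp (- \<mu> * t) *\<^sub>R T t x) \<le> exp (- \<mu> * t) * (K * exp (\<omega> * t))"
      using orbit[of t] assms by simp
    also have "\<dots> = g t" by (simp add: g_def \<nu>_def algebra_simps flip: exp_add)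
    finally show "norm (exp (- \<mu> * t) *\<^sub>R T t x) \<le> g t" .
  qed
  also have "integral {a..b} g \<le> K / (\<mu> - \<omega>) * exp (- (\<mu> - \<omega>) * a)"
    using integral_unique[OF int] K \<nu> by (simp add: \<nu>_def)
  finally show ?thesis using truncated_laplace_diff[OF assms(3,4)] by simp
qed

lemma laplace_tail:
  assumes orbit: "\<And>t. t \<ge> 0 \<Longrightarrow> norm (T t x) \<le> K * exp (\<omega> * t)"
    and \<mu>: "\<omega> < \<mu>" and \<tau>: "0 \<le> \<tau>"
  shows "norm (laplace \<mu> x - truncated_laplace \<mu> \<tau> x) \<le> K / (\<mu> - \<omega>) * exp (- (\<mu> - \<omega>) * \<tau>)"
proof -
  let ?u = "\<lambda>n. truncated_laplace \<mu> (real n) x"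
  let ?e = "\<lambda>s. K / (\<mu> - \<omega>) * exp (- (\<mu> - \<omega>) * s)"
  have e0: "(\<lambda>n. ?e (real n)) \<longlonglongrightarrow> 0"
  proof -
    have "filterlim (\<lambda>n. - (\<mu> - \<omega>) * real n) at_bot sequentially"
      using \<mu> by (intro filterlim_tendsto_neg_mult_at_bot[OF tendsto_const _ filterlim_real_sequentially]) auto
    then show ?thesis
      by (intro tendsto_mult_right_zero filterlim_compose[OF exp_at_bot])
  qed
  have "Cauchy ?u"
  proof (rule metric_CauchyI)
    fix e :: real assume "e > 0"
    then obtain N where N: "\<And>n. n \<ge> N \<Longrightarrow> ?e (real n) < e / 2"
      using order_tendstoD(2)[OF e0, of "e / 2"] by (auto simp: eventually_sequentially)
    have "dist (?u m) (?u n) < e" if "m \<ge> N" "n \<ge> N" for m n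
    proof -
      have "norm (?u k - ?u N) < e / 2" if "k \<ge> N" for k
        using truncated_laplace_increment[OF orbit \<mu>, of "real N" "real k"] N[of N] that
        by (meson le_less_trans of_nat_0_le_iff of_nat_le_iff order_refl)
      then have "dist (?u m) (?u N) < e / 2" "dist (?u n) (?u N) < e / 2"
        using that by (auto simp: dist_norm)
      then show ?thesis by (rule dist_triangle_half_l)
    qed
    then show "\<exists>N. \<forall>m\<ge>N. \<forall>n\<ge>N. dist (?u m) (?u n) < e" by blast
  qed
  then have lim: "?u \<longlonglongrightarrow> laplace \<mu> x"
    unfolding laplace_def by (simp add: Cauchy_convergent convergent_LIMSEQ_iff[THEN iffD1])
  have "(\<lambda>n. norm (?u n - truncated_laplace \<mu> \<tau> x)) \<longlonglongrightarrow> norm (laplace \<mu> x - truncated_laplace \<mu> \<tau> x)"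
    by (intro tendsto_intros lim)
  moreover have "\<forall>\<^sub>F n in sequentially. norm (?u n - truncated_laplace \<mu> \<tau> x) \<le> ?e \<tau>"
    using eventually_ge_at_top[of "nat \<lceil>\<tau>\<rceil>"]
    by eventually_elim (rule truncated_laplace_increment[OF orbit \<mu> \<tau>], auto simp: nat_le_iff ceiling_le_iff)
  ultimately show ?thesis
    by (rule tendsto_upperbound) simp
qed

lemma tendsto_laplace:
  assumes \<mu>: "\<omega> < \<mu>"
  shows "((\<lambda>\<tau>. truncated_laplace \<mu> \<tau> x) \<longlongrightarrow> laplace \<mu> x) at_top"
proof -
  have "((\<lambda>s. exp (- (\<mu> - \<omega>) * s)) \<longlongrightarrow> 0) at_top"
    using \<mu> by (intro filterlim_compose[OF exp_at_bot]
        filterlim_tendsto_neg_mult_at_bot[OF tendsto_const _ filterlim_ident]) auto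
  then have "((\<lambda>s. M * norm x / (\<mu> - \<omega>) * exp (- (\<mu> - \<omega>) * s)) \<longlongrightarrow> 0) at_top"
    by (rule tendsto_mult_right_zero)
  moreover have "\<forall>\<^sub>F \<tau> in at_top. norm (truncated_laplace \<mu> \<tau> x - laplace \<mu> x)
      \<le> M * norm x / (\<mu> - \<omega>) * exp (- (\<mu> - \<omega>) * \<tau>)"
    using eventually_ge_at_top[of 0]
  proof eventually_elim
    case (elim \<tau>)
    show ?case
      using laplace_tail[of x "M * norm x" \<mu> \<tau>] growth[of _ x] \<mu> elim
      by (simp add: norm_minus_commute algebra_simps)
  qed
  ultimately have "((\<lambda>\<tau>. truncated_laplace \<mu> \<tau> x - laplace \<mu> x) \<longlongrightarrow> 0) at_top"
    by (rule Lim_null_comparison[rotated])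
  then show ?thesis using LIM_zero_iff by blast
qed

lemma laplace_commute:
  assumes \<mu>: "\<omega> < \<mu>" and s: "s \<ge> 0"
  shows "T s (laplace \<mu> x) = laplace \<mu> (T s x)"
proof -
  interpret bounded_linear "T s" by (rule bounded_linear_op) fact
  have trunc: "T s (truncated_laplace \<mu> \<tau> x) = truncated_laplace \<mu> \<tau> (T s x)" for \<tau>
  proof -
    have "T s (truncated_laplace \<mu> \<tau> x) = integral {0..\<tau>} (T s \<circ> (\<lambda>t. exp (- \<mu> * t) *\<^sub>R T t x))"
      unfolding truncated_laplace_def
      by (rule integral_linear[symmetric, OF integrable_weighted bounded_linear_op]) (use s in auto)
    also have "\<dots> = truncated_laplace \<mu> \<tau> (T s x)"
      unfolding truncated_laplace_def using s
      by (intro Henstock_Kurzweil_Integration.integral_cong) (simp add: scaleR commute)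
    finally show ?thesis .
  qed
  have "((\<lambda>\<tau>. T s (truncated_laplace \<mu> \<tau> x)) \<longlongrightarrow> T s (laplace \<mu> x)) at_top"
    by (intro tendsto tendsto_laplace \<mu>)
  moreover have "((\<lambda>\<tau>. T s (truncated_laplace \<mu> \<tau> x)) \<longlongrightarrow> laplace \<mu> (T s x)) at_top"
    unfolding trunc by (intro tendsto_laplace \<mu>)
  ultimately show ?thesis by (rule tendsto_unique[OF trivial_limit_at_top_linorder])
qed

text \<open>
  The Hille-Yosida estimate in a form that can be iterated: the hypothesis on the orbit of \<open>x\<close> returns
  as a conclusion on the orbit of \<open>laplace \<mu> x\<close>, with \<open>K\<close> divided by \<open>\<mu> - \<omega>\<close>.
\<close>

lemma laplace_orbit_bound:
  assumes orbit: "\<And>t. t \<ge> 0 \<Longrightarrow> norm (T t x) \<le> K * exp (\<omega> * t)"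
    and \<mu>: "\<omega> < \<mu>" and s: "s \<ge> 0"
  shows "norm (T s (laplace \<mu> x)) \<le> K / (\<mu> - \<omega>) * exp (\<omega> * s)"
proof -
  have "norm (T t (T s x)) \<le> K * exp (\<omega> * s) * exp (\<omega> * t)" if "t \<ge> 0" for t
    using orbit[of "t + s"] that s semigroup[of t s x] by (simp add: algebra_simps exp_add)
  from laplace_tail[OF this \<mu>, of 0] show ?thesis
    using s \<mu> by (simp add: laplace_commute truncated_laplace_def algebra_simps)
qed

lemma bounded_linear_laplace:
  assumes \<mu>: "\<omega> < \<mu>"
  shows "bounded_linear (laplace \<mu>)"
proof (rule bounded_linear_intro)
  have add: "T t (x + y) = T t x + T t y" and sc: "T t (r *\<^sub>R x) = r *\<^sub>R T t x" if "t \<ge> 0" for t x y r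
    using bounded_linear_op[OF that] by (simp_all add: linear_simps)
  fix x y :: 'a and r :: real
  have eq: "truncated_laplace \<mu> \<tau> (x + y) = truncated_laplace \<mu> \<tau> x + truncated_laplace \<mu> \<tau> y" for \<tau>
  proof -
    have "truncated_laplace \<mu> \<tau> (x + y)
        = integral {0..\<tau>} (\<lambda>t. exp (- \<mu> * t) *\<^sub>R T t x + exp (- \<mu> * t) *\<^sub>R T t y)"
      unfolding truncated_laplace_def
      by (intro Henstock_Kurzweil_Integration.integral_cong) (simp add: add scaleR_add_right)
    also have "\<dots> = truncated_laplace \<mu> \<tau> x + truncated_laplace \<mu> \<tau> y"
      unfolding truncated_laplace_def
      by (intro Henstock_Kurzweil_Integration.integral_add integrable_weighted) auto
    finally show ?thesis .
  qed
  have "((\<lambda>\<tau>. truncated_laplace \<mu> \<tau> (x + y)) \<longlongrightarrow> laplace \<mu> x + laplace \<mu> y) at_top"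
    unfolding eq by (intro tendsto_add tendsto_laplace \<mu>)
  then show "laplace \<mu> (x + y) = laplace \<mu> x + laplace \<mu> y"
    using tendsto_laplace[OF \<mu>] tendsto_unique[OF trivial_limit_at_top_linorder] by blast
  have eq: "truncated_laplace \<mu> \<tau> (r *\<^sub>R x) = r *\<^sub>R truncated_laplace \<mu> \<tau> x" for \<tau>
  proof -
    have "truncated_laplace \<mu> \<tau> (r *\<^sub>R x) = integral {0..\<tau>} (\<lambda>t. r *\<^sub>R (exp (- \<mu> * t) *\<^sub>R T t x))"
      unfolding truncated_laplace_def
      by (intro Henstock_Kurzweil_Integration.integral_cong) (simp add: sc mult.commute)
    then show ?thesis
      unfolding truncated_laplace_def by (simp only: Henstock_Kurzweil_Integration.integral_cmul)
  qed
  have "((\<lambda>\<tau>. truncated_laplace \<mu> \<tau> (r *\<^sub>R x)) \<longlongrightarrow> r *\<^sub>R laplace \<mu> x) at_top"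
    unfolding eq by (intro tendsto_scaleR tendsto_const tendsto_laplace \<mu>)
  then show "laplace \<mu> (r *\<^sub>R x) = r *\<^sub>R laplace \<mu> x"
    using tendsto_laplace[OF \<mu>] tendsto_unique[OF trivial_limit_at_top_linorder] by blast
  show "norm (laplace \<mu> x) \<le> norm x * (M / (\<mu> - \<omega>))"
    using laplace_orbit_bound[of x "M * norm x" \<mu> 0] growth[of _ x] \<mu>
    by (simp add: at_zero algebra_simps)
qed

lemma truncated_laplace_shift:
  assumes "0 \<le> h" "0 \<le> \<tau>"
  shows "exp (- \<mu> * h) *\<^sub>R T h (truncated_laplace \<mu> \<tau> x)
    = truncated_laplace \<mu> (\<tau> + h) x - truncated_laplace \<mu> h x"
proof -
  interpret bounded_linear "T h" by (rule bounded_linear_op) fact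
  let ?f = "\<lambda>t. exp (- \<mu> * t) *\<^sub>R T t x"
  have "exp (- \<mu> * h) *\<^sub>R T h (truncated_laplace \<mu> \<tau> x)
      = integral {0..\<tau>} ((\<lambda>y. exp (- \<mu> * h) *\<^sub>R T h y) \<circ> ?f)"
    unfolding truncated_laplace_def using assms
    by (intro integral_linear[symmetric] integrable_weighted
        bounded_linear_const_scaleR[THEN bounded_linear_compose] bounded_linear_op) auto
  also have "\<dots> = integral {0..\<tau>} (?f \<circ> (+) h)"
    using assms by (intro Henstock_Kurzweil_Integration.integral_cong)
      (simp add: scaleR semigroup ring_distribs flip: exp_add)
  also have "\<dots> = integral {h..\<tau> + h} ?f"
    using integral_shift_cbox_plus[of 0 \<tau> ?f h] by simp
  also have "\<dots> = truncated_laplace \<mu> (\<tau> + h) x - truncated_laplace \<mu> h x"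
    using assms by (intro truncated_laplace_diff[symmetric]) auto
  finally show ?thesis .
qed

text \<open>
  Substituting \<open>t + h\<close> for \<open>t\<close> in the Laplace integral only cuts off the piece over \<open>[0, h]\<close>. This is the
  algebraic source of the resolvent equation: the cut off piece divided by \<open>h\<close> converges to \<open>x\<close>.
\<close>

lemma laplace_shift:
  assumes \<mu>: "\<omega> < \<mu>" and h: "0 \<le> h"
  shows "exp (- \<mu> * h) *\<^sub>R T h (laplace \<mu> x) = laplace \<mu> x - truncated_laplace \<mu> h x"
proof -
  interpret bounded_linear "T h" by (rule bounded_linear_op) fact
  have shifted: "filterlim (\<lambda>\<tau>. \<tau> + h) at_top at_top"
    by (subst add.commute, intro filterlim_tendsto_add_at_top[OF tendsto_const] filterlim_ident)
  have "((\<lambda>\<tau>. exp (- \<mu> * h) *\<^sub>R T h (truncated_laplace \<mu> \<tau> x))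
      \<longlongrightarrow> exp (- \<mu> * h) *\<^sub>R T h (laplace \<mu> x)) at_top"
    by (intro tendsto_intros tendsto tendsto_laplace \<mu>)
  moreover have "((\<lambda>\<tau>. exp (- \<mu> * h) *\<^sub>R T h (truncated_laplace \<mu> \<tau> x))
      \<longlongrightarrow> laplace \<mu> x - truncated_laplace \<mu> h x) at_top"
  proof (rule Lim_transform_eventually)
    show "((\<lambda>\<tau>. truncated_laplace \<mu> (\<tau> + h) x - truncated_laplace \<mu> h x)
        \<longlongrightarrow> laplace \<mu> x - truncated_laplace \<mu> h x) at_top"
      by (intro tendsto_intros filterlim_compose[OF tendsto_laplace[OF \<mu>] shifted])
    show "\<forall>\<^sub>F \<tau> in at_top. truncated_laplace \<mu> (\<tau> + h) x - truncated_laplace \<mu> h x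
        = exp (- \<mu> * h) *\<^sub>R T h (truncated_laplace \<mu> \<tau> x)"
      using eventually_ge_at_top[of 0] by eventually_elim (rule truncated_laplace_shift[OF h, symmetric])
  qed
  ultimately show ?thesis by (rule tendsto_unique[OF trivial_limit_at_top_linorder])
qed

lemma truncated_laplace_average: "((\<lambda>h. truncated_laplace \<mu> h x /\<^sub>R h) \<longlongrightarrow> x) (at_right 0)"
proof -
  have "continuous_on {0..1} (\<lambda>t. exp (- \<mu> * t) *\<^sub>R T t x)"
    by (rule continuous_on_subset[OF continuous_weighted]) auto
  then have "((\<lambda>u. truncated_laplace \<mu> u x) has_vector_derivative exp (- \<mu> * 0) *\<^sub>R T 0 x) (at 0 within {0..1})"
    unfolding truncated_laplace_def by (rule integral_has_vector_derivative) simp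
  then have "((\<lambda>h. (truncated_laplace \<mu> h x - h *\<^sub>R x) /\<^sub>R norm h) \<longlongrightarrow> 0) (at_right 0)"
    by (simp add: has_vector_derivative_def has_derivative_within at_zero truncated_laplace_def
        at_within_Icc_at_right divide_inverse_commute)
  then have "((\<lambda>h. truncated_laplace \<mu> h x /\<^sub>R h - x) \<longlongrightarrow> 0) (at_right 0)"
  proof (rule Lim_transform_eventually)
    show "\<forall>\<^sub>F h in at_right 0. (truncated_laplace \<mu> h x - h *\<^sub>R x) /\<^sub>R norm h
        = truncated_laplace \<mu> h x /\<^sub>R h - x"
      using eventually_at_right_less[of 0] by eventually_elim (simp add: scaleR_diff_right)
  qed
  then show ?thesis using LIM_zero_iff by blast
qed

lemma laplace_difference_quotient:
  assumes \<mu>: "\<omega> < \<mu>"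
  shows "((\<lambda>h. (T h (laplace \<mu> x) - laplace \<mu> x) /\<^sub>R h) \<longlongrightarrow> \<mu> *\<^sub>R laplace \<mu> x - x) (at_right 0)"
proof (rule Lim_transform_eventually)
  have "((\<lambda>h. exp (\<mu> * h)) has_real_derivative \<mu>) (at 0 within {0<..})"
    by (auto intro!: derivative_eq_intros)
  then have q: "((\<lambda>h. (exp (\<mu> * h) - 1) / h) \<longlongrightarrow> \<mu>) (at_right 0)"
    by (simp add: has_field_derivative_iff)
  have e: "((\<lambda>h. exp (\<mu> * h)) \<longlongrightarrow> 1) (at_right 0)"
    by (auto intro!: tendsto_eq_intros)
  show "((\<lambda>h. ((exp (\<mu> * h) - 1) / h) *\<^sub>R laplace \<mu> x
        - exp (\<mu> * h) *\<^sub>R (truncated_laplace \<mu> h x /\<^sub>R h)) \<longlongrightarrow> \<mu> *\<^sub>R laplace \<mu> x - x) (at_right 0)"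
    using tendsto_diff[OF tendsto_scaleR[OF q tendsto_const[of "laplace \<mu> x"]]
        tendsto_scaleR[OF e truncated_laplace_average[of \<mu> x]]] by simp
  show "\<forall>\<^sub>F h in at_right 0. ((exp (\<mu> * h) - 1) / h) *\<^sub>R laplace \<mu> x
        - exp (\<mu> * h) *\<^sub>R (truncated_laplace \<mu> h x /\<^sub>R h) = (T h (laplace \<mu> x) - laplace \<mu> x) /\<^sub>R h"
    using eventually_at_right_less[of 0]
  proof eventually_elim
    case (elim h)
    have "T h (laplace \<mu> x) = exp (\<mu> * h) *\<^sub>R exp (- \<mu> * h) *\<^sub>R T h (laplace \<mu> x)"
      by (simp flip: exp_add)
    also have "\<dots> = exp (\<mu> * h) *\<^sub>R (laplace \<mu> x - truncated_laplace \<mu> h x)"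
      using elim by (simp only: laplace_shift[OF \<mu>])
    finally have "T h (laplace \<mu> x) = exp (\<mu> * h) *\<^sub>R (laplace \<mu> x - truncated_laplace \<mu> h x)" .
    then show ?case
      by (simp only:) (simp add: algebra_simps divide_inverse)
  qed
qed

context
  fixes D :: "'a set" and A :: "'a \<Rightarrow> 'a"
  assumes gen: "generator_of T D A"
begin

lemma generator_limit: "x \<in> D \<Longrightarrow> ((\<lambda>t. (T t x - x) /\<^sub>R t) \<longlongrightarrow> A x) (at_right 0)"
  using gen by (simp add: generator_of_def)

lemma generator_eqI:
  assumes "((\<lambda>t. (T t x - x) /\<^sub>R t) \<longlongrightarrow> y) (at_right 0)"
  shows "x \<in> D" "A x = y"
proof -
  show D: "x \<in> D" using gen assms by (auto simp: generator_of_def)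
  show "A x = y"
    using tendsto_unique[OF _ generator_limit[OF D] assms] by simp
qed

lemma laplace_generator_right:
  assumes "\<omega> < \<mu>"
  shows "laplace \<mu> x \<in> D" "\<mu> *\<^sub>R laplace \<mu> x - A (laplace \<mu> x) = x"
  using generator_eqI[OF laplace_difference_quotient[OF assms, of x]] by auto

text \<open>
  The Laplace transform is bounded and commutes with the semigroup, hence it may be applied to the
  difference quotient that defines \<open>A x\<close>, and the limit of the result is already known.
\<close>

lemma laplace_generator_left:
  assumes \<mu>: "\<omega> < \<mu>" and x: "x \<in> D"
  shows "laplace \<mu> (A x) = \<mu> *\<^sub>R laplace \<mu> x - x"
proof -
  interpret R: bounded_linear "laplace \<mu>" by (rule bounded_linear_laplace[OF \<mu>])
  have "((\<lambda>t. laplace \<mu> ((T t x - x) /\<^sub>R t)) \<longlongrightarrow> laplace \<mu> (A x)) (at_right 0)"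
    by (intro R.tendsto generator_limit x)
  moreover have "((\<lambda>t. laplace \<mu> ((T t x - x) /\<^sub>R t)) \<longlongrightarrow> \<mu> *\<^sub>R laplace \<mu> x - x) (at_right 0)"
  proof (rule Lim_transform_eventually[OF laplace_difference_quotient[OF \<mu>]])
    show "\<forall>\<^sub>F t in at_right 0. (T t (laplace \<mu> x) - laplace \<mu> x) /\<^sub>R t = laplace \<mu> ((T t x - x) /\<^sub>R t)"
      using eventually_at_right_less[of 0]
      by eventually_elim (simp add: R.scaleR R.diff laplace_commute \<mu>)
  qed
  ultimately show ?thesis by (intro tendsto_unique[OF _]) auto
qed

theorem resolvent_eq_laplace:
  assumes \<mu>: "\<omega> < \<mu>"
  shows "resolvent D A \<mu> = laplace \<mu>"
proof
  fix x
  have "inj_on (\<lambda>x. \<mu> *\<^sub>R x - A x) D"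
  proof (rule inj_on_inverseI)
    fix y assume y: "y \<in> D"
    interpret R: bounded_linear "laplace \<mu>" by (rule bounded_linear_laplace[OF \<mu>])
    show "laplace \<mu> (\<mu> *\<^sub>R y - A y) = y"
      using laplace_generator_left[OF \<mu> y] by (simp add: R.diff R.scaleR)
  qed
  then show "resolvent D A \<mu> x = laplace \<mu> x"
    unfolding resolvent_def
    using laplace_generator_right[OF \<mu>, of x] by (intro inv_into_f_eq) auto
qed

text \<open>
  The averages of the orbit over short times lie in the domain: the difference quotient at time \<open>t\<close> of an
  average over \<open>[0, s]\<close> equals that at time \<open>s\<close> of the average over \<open>[0, t]\<close>, which converges as
  \<open>t\<close> tends to \<open>0\<close>.
\<close>

lemma domain_dense:
  obtains y where "\<And>n. y n \<in> D" "y \<longlonglongrightarrow> x"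
proof
  define h where "h n = inverse (real (Suc n))" for n
  have h: "h n > 0" for n by (simp add: h_def)
  have "h \<longlonglongrightarrow> 0" unfolding h_def by (rule LIMSEQ_inverse_real_of_nat)
  then have "filterlim h (at_right 0) sequentially"
    using h by (simp add: filterlim_at less_imp_neq[OF h, THEN not_sym])
  then show "(\<lambda>n. truncated_laplace 0 (h n) x /\<^sub>R h n) \<longlonglongrightarrow> x"
    by (rule filterlim_compose[OF truncated_laplace_average])
  have D: "truncated_laplace 0 s x /\<^sub>R s \<in> D" if "s > 0" for s
  proof (rule generator_eqI)
    have eq: "T t (truncated_laplace 0 s x) - truncated_laplace 0 s x
        = T s (truncated_laplace 0 t x) - truncated_laplace 0 t x" if "t \<ge> 0" for t
      using truncated_laplace_shift[of t s 0 x] truncated_laplace_shift[of s t 0 x] \<open>s > 0\<close> that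
      by (simp add: algebra_simps)
    interpret S: bounded_linear "T s" by (rule bounded_linear_op) (use \<open>s > 0\<close> in simp)
    show "((\<lambda>t. (T t (truncated_laplace 0 s x /\<^sub>R s) - truncated_laplace 0 s x /\<^sub>R s) /\<^sub>R t)
        \<longlongrightarrow> (T s x - x) /\<^sub>R s) (at_right 0)"
    proof (rule Lim_transform_eventually)
      show "((\<lambda>t. (T s (truncated_laplace 0 t x /\<^sub>R t) - truncated_laplace 0 t x /\<^sub>R t) /\<^sub>R s)
          \<longlongrightarrow> (T s x - x) /\<^sub>R s) (at_right 0)"
        by (intro tendsto_intros S.tendsto truncated_laplace_average)
      show "\<forall>\<^sub>F t in at_right 0. (T s (truncated_laplace 0 t x /\<^sub>R t) - truncated_laplace 0 t x /\<^sub>R t) /\<^sub>R s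
          = (T t (truncated_laplace 0 s x /\<^sub>R s) - truncated_laplace 0 s x /\<^sub>R s) /\<^sub>R t"
        using eventually_at_right_less[of 0]
      proof eventually_elim
        case (elim t)
        interpret bounded_linear "T t" by (rule bounded_linear_op) (use elim in simp)
        show ?case
          using eq[of t] elim
          by (simp add: S.scaleR scaleR mult.commute flip: scaleR_diff_right)
      qed
    qed
  qed
  show "truncated_laplace 0 (h n) x /\<^sub>R h n \<in> D" for n by (rule D[OF h])
qed

end

end

section \<open>The exponential formula\<close>

text \<open>
  The comparison of two evolutions by the sum of their local errors, each transported by \<open>F\<close>.
\<close>

lemma funpow_diff_telescope:
  fixes F G :: "'a::real_vector \<Rightarrow> 'a"
  assumes "linear F"
  shows "(F ^^ n) x - (G ^^ n) x
    = (\<Sum>k<n. (F ^^ (n - 1 - k)) (F ((G ^^ k) x) - G ((G ^^ k) x)))"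
proof (induction n)
  case 0
  then show ?case by simp
next
  case (Suc n)
  have shift: "F ((F ^^ (n - Suc k)) y) = (F ^^ (n - k)) y" if "k < n" for k y
  proof -
    have "n - k = Suc (n - Suc k)" using that by simp
    then show ?thesis by simp
  qed
  have "(F ^^ Suc n) x - (G ^^ Suc n) x
      = F ((F ^^ n) x - (G ^^ n) x) + (F ((G ^^ n) x) - G ((G ^^ n) x))"
    using assms by (simp add: linear_diff)
  also have "F ((F ^^ n) x - (G ^^ n) x)
      = (\<Sum>k<n. (F ^^ (n - k)) (F ((G ^^ k) x) - G ((G ^^ k) x)))"
    unfolding Suc using assms by (simp add: linear_sum) (auto intro!: sum.cong shift)
  finally show ?case by simp
qed

lemma tendsto_of_dense:
  fixes F :: "nat \<Rightarrow> 'a::real_normed_vector \<Rightarrow> 'b::real_normed_vector"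
  assumes lin: "\<forall>\<^sub>F n in sequentially. bounded_linear (F n)"
    and bound: "\<forall>\<^sub>F n in sequentially. \<forall>x. norm (F n x) \<le> C * norm x"
    and G: "bounded_linear G"
    and conv: "\<And>k. (\<lambda>n. F n (y k)) \<longlonglongrightarrow> G (y k)"
    and y: "y \<longlonglongrightarrow> x"
  shows "(\<lambda>n. F n x) \<longlonglongrightarrow> G x"
proof (rule metric_LIMSEQ_I)
  fix e :: real assume "e > 0"
  interpret G: bounded_linear G by (rule G)
  have "(\<lambda>k. C * norm (x - y k) + norm (G (y k) - G x)) \<longlonglongrightarrow> C * norm (x - x) + norm (G x - G x)"
    by (intro tendsto_intros y G.tendsto)
  then have "\<forall>\<^sub>F k in sequentially. C * norm (x - y k) + norm (G (y k) - G x) < e / 2"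
    by (rule order_tendstoD) (use \<open>e > 0\<close> in simp)
  then obtain k where k: "C * norm (x - y k) + norm (G (y k) - G x) < e / 2"
    by (meson eventually_happens' sequentially_bot)
  have "\<forall>\<^sub>F n in sequentially. dist (F n (y k)) (G (y k)) < e / 2"
    using conv[of k] \<open>e > 0\<close> by (intro tendstoD) auto
  then have "\<forall>\<^sub>F n in sequentially. dist (F n x) (G x) < e"
    using lin bound
  proof eventually_elim
    case (elim n)
    then interpret bounded_linear "F n" by blast
    have "F n x - G x = F n (x - y k) + (F n (y k) - G (y k)) + (G (y k) - G x)"
      by (simp add: diff)
    then have "norm (F n x - G x) \<le> norm (F n (x - y k)) + norm (F n (y k) - G (y k)) + norm (G (y k) - G x)"
      by (metis norm_triangle_mono norm_triangle_ineq order_refl)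
    moreover have "norm (F n (x - y k)) \<le> C * norm (x - y k)" using elim by blast
    ultimately show ?case using elim(1) k by (simp add: dist_norm)
  qed
  then show "\<exists>N. \<forall>n\<ge>N. dist (F n x) (G x) < e" by (simp add: eventually_sequentially)
qed

context growth_bounded_semigroup
begin

text \<open>
  This is \<open>(I - h A)\<^sup>-\<^sup>1\<close> for \<open>h = 1 / \<mu>\<close>, one step of the implicit Euler scheme of step size \<open>h\<close>. The
  Yosida approximation at \<open>\<mu>\<close> is \<open>\<mu>\<close> times the difference of this operator and the identity.
\<close>

definition euler_step :: "real \<Rightarrow> 'a \<Rightarrow> 'a" where
  "euler_step \<mu> x = \<mu> *\<^sub>R laplace \<mu> x"

lemma bounded_linear_euler_step: "\<omega> < \<mu> \<Longrightarrow> bounded_linear (euler_step \<mu>)"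
  unfolding euler_step_def
  by (intro bounded_linear_compose[OF bounded_linear_scaleR_right] bounded_linear_laplace)

lemma euler_step_commute: "\<omega> < \<mu> \<Longrightarrow> s \<ge> 0 \<Longrightarrow> T s (euler_step \<mu> x) = euler_step \<mu> (T s x)"
  unfolding euler_step_def
  using bounded_linear_op[of s] by (simp add: laplace_commute linear_simps)

text \<open>
  Keeping the semigroup operator \<open>T s\<close> in the statement makes the induction work: the constant \<open>M\<close> is
  spent once, at the start, and not once for every power.
\<close>

lemma euler_step_funpow_bound:
  assumes \<mu>: "\<omega> < \<mu>" and s: "s \<ge> 0"
  shows "norm (T s ((euler_step \<mu> ^^ k) x)) \<le> M * (\<mu> / (\<mu> - \<omega>)) ^ k * norm x * exp (\<omega> * s)"
  using s
proof (induction k arbitrary: s)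
  case 0
  then show ?case using growth[of s x] by (simp add: algebra_simps)
next
  case (Suc k)
  interpret bounded_linear "T s" by (rule bounded_linear_op) fact
  let ?y = "(euler_step \<mu> ^^ k) x"
  have "norm (T s ((euler_step \<mu> ^^ Suc k) x)) = \<mu> * norm (T s (laplace \<mu> ?y))"
    using \<mu> \<omega>_nonneg by (simp add: euler_step_def scaleR)
  also have "\<dots> \<le> \<mu> * (M * (\<mu> / (\<mu> - \<omega>)) ^ k * norm x / (\<mu> - \<omega>) * exp (\<omega> * s))"
    using \<mu> \<omega>_nonneg Suc by (intro mult_left_mono laplace_orbit_bound) auto
  finally show ?case by (simp add: algebra_simps)
qed

text \<open>
  The hypothesis on \<open>n\<close> gives \<open>\<omega> t / n \<le> 1/2\<close>, and \<open>1 / (1 - z) \<le> 1 + 2 z\<close> for \<open>0 \<le> z \<le> 1/2\<close>. That is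
  where the factor \<open>2\<close> in the exponent comes from. The summand with \<open>c\<close> leaves room for a perturbation
  of the Euler step.
\<close>

lemma euler_step_power_le_exp:
  fixes t :: real
  assumes "2 * \<omega> * t \<le> real n" "n > 0" "t > 0" "c \<ge> 0"
  shows "(real n / t / (real n / t - \<omega>) + c * t / n) ^ n \<le> exp ((2 * \<omega> + c) * t)"
proof -
  have pos: "real n / t - \<omega> > 0"
  proof -
    have "\<omega> * t \<le> real n / 2" using assms by simp
    also have "\<dots> < n" using assms by simp
    finally show ?thesis using assms by (simp add: field_simps)
  qed
  have "2 * \<omega> * t * (\<omega> * t) \<le> real n * (\<omega> * t)"
    using assms \<omega>_nonneg by (intro mult_right_mono) auto
  then have q: "real n / t / (real n / t - \<omega>) \<le> 1 + 2 * \<omega> * t / n"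
    using pos assms by (simp add: field_simps)
  have "real n / t / (real n / t - \<omega>) + c * t / n \<le> 1 + ((2 * \<omega> + c) * t) / n"
    using q by (simp add: algebra_simps add_divide_distrib)
  also have "\<dots> \<le> exp (((2 * \<omega> + c) * t) / n)" by (rule exp_ge_add_one_self)
  finally have "(real n / t / (real n / t - \<omega>) + c * t / n) ^ n \<le> exp (((2 * \<omega> + c) * t) / n) ^ n"
    using pos assms by (intro power_mono) auto
  also have "\<dots> = exp ((2 * \<omega> + c) * t)"
    using assms by (simp flip: exp_of_nat_mult)
  finally show ?thesis .
qed

lemma euler_step_funpow_bound_uniform:
  assumes "t > 0" "2 * \<omega> * t \<le> real n" "n > 0" "k \<le> n"
  shows "norm ((euler_step (real n / t) ^^ k) x) \<le> M * exp (2 * \<omega> * t) * norm x"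
proof -
  let ?\<mu> = "real n / t"
  have "\<omega> * t < n" using assms by simp
  then have \<mu>: "\<omega> < ?\<mu>" using assms by (simp add: field_simps)
  have "z / (z - \<omega>) \<ge> 1" if "\<omega> < z" for z
    using that \<omega>_nonneg by (simp add: field_simps)
  from this[OF \<mu>] have q: "?\<mu> / (?\<mu> - \<omega>) \<ge> 1" .
  have "norm ((euler_step ?\<mu> ^^ k) x) \<le> M * (?\<mu> / (?\<mu> - \<omega>)) ^ k * norm x"
    using euler_step_funpow_bound[OF \<mu>, of 0 k x] by (simp add: at_zero)
  also have "\<dots> \<le> M * (?\<mu> / (?\<mu> - \<omega>)) ^ n * norm x"
    using q assms M_ge_1 by (intro mult_right_mono mult_left_mono power_increasing) auto
  also have "\<dots> \<le> M * exp (2 * \<omega> * t) * norm x"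
    using euler_step_power_le_exp[of t n 0] assms M_ge_1
    by (intro mult_right_mono mult_left_mono) auto
  finally show ?thesis .
qed

context
  fixes D :: "'a set" and A :: "'a \<Rightarrow> 'a"
  assumes gen: "generator_of T D A"
begin

lemma euler_step_on_domain:
  assumes \<mu>: "\<omega> < \<mu>" and x: "x \<in> D"
  shows "euler_step \<mu> x = x + laplace \<mu> (A x)"
  using laplace_generator_left[OF gen \<mu> x] by (simp add: euler_step_def)

lemma euler_step_tendsto_id:
  assumes "filterlim \<mu> at_top sequentially"
  shows "(\<lambda>n. euler_step (\<mu> n) x) \<longlonglongrightarrow> x"
proof -
  obtain y where y: "\<And>k. y k \<in> D" "y \<longlonglongrightarrow> x" using domain_dense[OF gen] by blast
  have large: "\<forall>\<^sub>F n in sequentially. 2 * \<omega> + 1 \<le> \<mu> n"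
    using assms by (simp add: filterlim_at_top)
  show ?thesis
  proof (rule tendsto_of_dense[where C = "2 * M" and G = "\<lambda>x. x" and y = y])
    show "\<forall>\<^sub>F n in sequentially. bounded_linear (euler_step (\<mu> n))"
      using large by eventually_elim (rule bounded_linear_euler_step, use \<omega>_nonneg in simp)
    show "\<forall>\<^sub>F n in sequentially. \<forall>x. norm (euler_step (\<mu> n) x) \<le> 2 * M * norm x"
      using large
    proof (eventually_elim, intro allI)
      fix n x assume n: "2 * \<omega> + 1 \<le> \<mu> n"
      then have "norm (euler_step (\<mu> n) x) \<le> M * (\<mu> n / (\<mu> n - \<omega>)) * norm x"
        using euler_step_funpow_bound[of "\<mu> n" 0 1 x] \<omega>_nonneg by (simp add: at_zero)
      also have "\<dots> \<le> M * 2 * norm x"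
        using n \<omega>_nonneg M_ge_1 by (intro mult_right_mono mult_left_mono) (auto simp: field_simps)
      finally show "norm (euler_step (\<mu> n) x) \<le> 2 * M * norm x" by simp
    qed
    show "bounded_linear (\<lambda>x::'a. x)" by (rule bounded_linear_ident)
    show "(\<lambda>n. euler_step (\<mu> n) (y k)) \<longlonglongrightarrow> y k" for k
    proof -
      have "filterlim (\<lambda>n. - \<omega> + \<mu> n) at_top sequentially"
        by (intro filterlim_tendsto_add_at_top[OF tendsto_const] assms)
      then have "(\<lambda>n. M * norm (A (y k)) / (- \<omega> + \<mu> n)) \<longlonglongrightarrow> 0"
        by (rule tendsto_divide_0[OF tendsto_const filterlim_at_top_imp_at_infinity])
      moreover have "\<forall>\<^sub>F n in sequentially. norm (euler_step (\<mu> n) (y k) - y k) \<le> M * norm (A (y k)) / (- \<omega> + \<mu> n)"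
        using large
      proof eventually_elim
        case (elim n)
        then have "\<omega> < \<mu> n" using \<omega>_nonneg by simp
        then show ?case
          using laplace_orbit_bound[of "A (y k)" "M * norm (A (y k))" "\<mu> n" 0] growth[of _ "A (y k)"]
          by (simp add: euler_step_on_domain y at_zero algebra_simps)
      qed
      ultimately have "(\<lambda>n. euler_step (\<mu> n) (y k) - y k) \<longlonglongrightarrow> 0"
        by (rule Lim_null_comparison[rotated])
      then show ?thesis using LIM_zero_iff by blast
    qed
  qed (rule y)
qed

text \<open>
  On the domain the Euler step and the semigroup agree to first order in the step size, because both
  difference quotients converge to \<open>A x\<close>.
\<close>

lemma euler_step_tangent:
  assumes "filterlim \<mu> at_top sequentially" and x: "x \<in> D"
  shows "(\<lambda>n. \<mu> n *\<^sub>R (euler_step (\<mu> n) x - T (1 / \<mu> n) x)) \<longlonglongrightarrow> 0"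
proof (rule Lim_transform_eventually)
  have large: "\<forall>\<^sub>F n in sequentially. \<omega> + 1 \<le> \<mu> n"
    using assms by (simp add: filterlim_at_top)
  have "(\<lambda>n. 1 / \<mu> n) \<longlonglongrightarrow> 0"
    by (rule tendsto_divide_0[OF tendsto_const filterlim_at_top_imp_at_infinity[OF assms(1)]])
  moreover have "\<forall>\<^sub>F n in sequentially. 1 / \<mu> n \<in> {0<..} \<and> 1 / \<mu> n \<noteq> 0"
    using large by eventually_elim (use \<omega>_nonneg in auto)
  ultimately have "filterlim (\<lambda>n. 1 / \<mu> n) (at_right 0) sequentially"
    by (simp only: filterlim_at)
  then have "(\<lambda>n. (T (1 / \<mu> n) x - x) /\<^sub>R (1 / \<mu> n)) \<longlonglongrightarrow> A x"
    by (rule filterlim_compose[OF generator_limit[OF gen x]])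
  then show "(\<lambda>n. euler_step (\<mu> n) (A x) - (T (1 / \<mu> n) x - x) /\<^sub>R (1 / \<mu> n)) \<longlonglongrightarrow> 0"
    using tendsto_diff[OF euler_step_tendsto_id[OF assms(1), of "A x"]] by fastforce
  show "\<forall>\<^sub>F n in sequentially. euler_step (\<mu> n) (A x) - (T (1 / \<mu> n) x - x) /\<^sub>R (1 / \<mu> n)
      = \<mu> n *\<^sub>R (euler_step (\<mu> n) x - T (1 / \<mu> n) x)"
    using large
  proof eventually_elim
    case (elim n)
    then have "\<omega> < \<mu> n" by simp
    then show ?case
      using euler_step_on_domain[of "\<mu> n" x] x by (simp add: euler_step_def algebra_simps)
  qed
qed

text \<open>
  For \<open>x\<close> in the domain the local error is \<open>o(1 / n)\<close>. It is the same at each of the \<open>n\<close> steps up to a bounded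
  factor, since everything commutes with the semigroup, and the powers of the Euler step are bounded; so
  the total error tends to \<open>0\<close>. Density of the domain gives the other points.
\<close>

theorem exponential_formula:
  assumes t: "t > 0"
  shows "(\<lambda>n. (euler_step (real n / t) ^^ n) x) \<longlonglongrightarrow> T t x"
proof -
  define J where "J n = euler_step (real n / t)" for n
  have large: "\<forall>\<^sub>F n in sequentially. 2 * \<omega> * t \<le> real n \<and> n > 0"
    using eventually_ge_at_top[of "nat \<lceil>2 * \<omega> * t\<rceil>"] eventually_gt_at_top[of 0]
    by eventually_elim (auto simp: nat_le_iff ceiling_le_iff)
  have \<mu>: "\<omega> < real n / t" if "2 * \<omega> * t \<le> real n \<and> n > 0" for n
  proof -
    have "\<omega> * t < n" using that by auto
    then show ?thesis using t by (simp add: field_simps)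
  qed
  have lin: "bounded_linear (J n)" if "2 * \<omega> * t \<le> real n \<and> n > 0" for n
    unfolding J_def using \<mu>[OF that] by (rule bounded_linear_euler_step)
  have J_bound: "norm ((J n ^^ k) y) \<le> M * exp (2 * \<omega> * t) * norm y"
    if "2 * \<omega> * t \<le> real n \<and> n > 0" "k \<le> n" for n k y
    unfolding J_def using that t by (intro euler_step_funpow_bound_uniform) auto
  have lin_pow: "bounded_linear (J n ^^ k)" if "2 * \<omega> * t \<le> real n \<and> n > 0" for n k
  proof (induction k)
    case 0
    then show ?case by (simp add: id_def bounded_linear_ident)
  next
    case (Suc k)
    then show ?case using bounded_linear_compose[OF lin[OF that] Suc] by (simp add: o_def)
  qed
  have at_top: "filterlim (\<lambda>n. real n / t) at_top sequentially"
    using filterlim_tendsto_pos_mult_at_top[OF tendsto_const[of "1 / t"] _ filterlim_real_sequentially] t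
    by simp
  have conv: "(\<lambda>n. (J n ^^ n) y) \<longlonglongrightarrow> T t y" if y: "y \<in> D" for y
  proof -
    define C where "C = M * exp (2 * \<omega> * t) * (M * exp (\<omega> * t))"
    have C: "C \<ge> 0" using M_ge_1 by (simp add: C_def)
    have "(\<lambda>n. C * t * norm ((real n / t) *\<^sub>R (J n y - T (1 / (real n / t)) y))) \<longlonglongrightarrow> 0"
      unfolding J_def using euler_step_tangent[OF at_top y]
      by (intro tendsto_mult_right_zero tendsto_norm_zero)
    moreover have "\<forall>\<^sub>F n in sequentially. norm ((J n ^^ n) y - T t y)
        \<le> C * t * norm ((real n / t) *\<^sub>R (J n y - T (1 / (real n / t)) y))"
      using large
    proof eventually_elim
      case (elim n)
      define h where "h = t / real n"
      have h: "h \<ge> 0" using t by (simp add: h_def)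
      interpret Jn: bounded_linear "J n" by (rule lin[OF elim])
      have summand: "norm ((J n ^^ (n - 1 - k)) (J n ((T h ^^ k) y) - T h ((T h ^^ k) y))) \<le> C * norm (J n y - T h y)"
        if "k < n" for k
      proof -
        let ?s = "real k * h"
        have s: "0 \<le> ?s" "?s \<le> t" using h t that by (auto simp: h_def field_simps)
        interpret bounded_linear "T ?s" by (rule bounded_linear_op) fact
        have "J n ((T h ^^ k) y) - T h ((T h ^^ k) y) = T ?s (J n y - T h y)"
          unfolding power_eq[OF h] J_def using s h \<mu>[OF elim]
          by (simp add: diff euler_step_commute commute)
        then have "norm ((J n ^^ (n - 1 - k)) (J n ((T h ^^ k) y) - T h ((T h ^^ k) y)))
            \<le> M * exp (2 * \<omega> * t) * norm (T ?s (J n y - T h y))"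
          using J_bound[OF elim] that by simp
        also have "norm (T ?s (J n y - T h y)) \<le> M * exp (\<omega> * ?s) * norm (J n y - T h y)"
          by (rule growth[OF s(1)])
        also have "\<dots> \<le> M * exp (\<omega> * t) * norm (J n y - T h y)"
          using s M_ge_1 \<omega>_nonneg by (intro mult_right_mono) (auto intro: mult_left_mono)
        finally show ?thesis using M_ge_1 by (simp add: C_def algebra_simps)
      qed
      have "T t y = (T h ^^ n) y"
        unfolding power_eq[OF h] using elim by (simp add: h_def)
      then have "norm ((J n ^^ n) y - T t y) \<le> (\<Sum>k<n. C * norm (J n y - T h y))"
        unfolding \<open>T t y = (T h ^^ n) y\<close> funpow_diff_telescope[OF Jn.linear]
        using summand by (intro sum_norm_le) auto
      also have "\<dots> = C * t * norm ((real n / t) *\<^sub>R (J n y - T h y))"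
        using t by simp
      finally show ?case by (simp add: h_def)
    qed
    ultimately have "(\<lambda>n. (J n ^^ n) y - T t y) \<longlonglongrightarrow> 0"
      by (rule Lim_null_comparison[rotated])
    then show ?thesis using LIM_zero_iff by blast
  qed
  obtain y where y: "\<And>k. y k \<in> D" "y \<longlonglongrightarrow> x" using domain_dense[OF gen] by blast
  have "(\<lambda>n. (J n ^^ n) x) \<longlonglongrightarrow> T t x"
  proof (rule tendsto_of_dense[where C = "M * exp (2 * \<omega> * t)" and G = "T t" and y = y])
    show "\<forall>\<^sub>F n in sequentially. bounded_linear (J n ^^ n)"
      using large by eventually_elim (rule lin_pow)
    show "\<forall>\<^sub>F n in sequentially. \<forall>x. norm ((J n ^^ n) x) \<le> M * exp (2 * \<omega> * t) * norm x"
      using large by eventually_elim (simp add: J_bound)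
    show "bounded_linear (T t)" using t by (intro bounded_linear_op) simp
  qed (use y conv in auto)
  then show ?thesis by (simp add: J_def)
qed

end

end

section \<open>From the Yosida distance to the distance of the semigroups\<close>

text \<open>
  A discrete Gronwall lemma. Only the powers of \<open>F\<close> are assumed to be bounded; the telescoping sum then
  bounds those of \<open>G\<close>, and it sums to exactly the difference of two powers.
\<close>

lemma funpow_perturbation:
  fixes F G :: "'a::real_normed_vector \<Rightarrow> 'a"
  assumes F: "linear F"
    and pow: "\<And>k x. norm ((F ^^ k) x) \<le> M * q ^ k * norm x"
    and close: "\<And>x. norm (F x - G x) \<le> \<epsilon> * norm x"
    and nonneg: "M \<ge> 0" "q \<ge> 0" "\<epsilon> \<ge> 0"
  shows "norm ((F ^^ n) x - (G ^^ n) x) \<le> M * ((q + M * \<epsilon>) ^ n - q ^ n) * norm x"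
proof (induction n rule: less_induct)
  case (less n)
  let ?r = "q + M * \<epsilon>"
  have G_bound: "norm ((G ^^ k) x) \<le> M * ?r ^ k * norm x" if "k < n" for k
    using norm_triangle_sub[of "(G ^^ k) x" "(F ^^ k) x"] less[OF that] pow[of k x]
    by (simp add: norm_minus_commute algebra_simps)
  have "norm ((F ^^ n) x - (G ^^ n) x)
      \<le> (\<Sum>k<n. M * q ^ (n - Suc k) * (\<epsilon> * (M * ?r ^ k * norm x)))"
    unfolding funpow_diff_telescope[OF F]
  proof (rule sum_norm_le)
    fix k assume "k \<in> {..<n}"
    then have "norm (F ((G ^^ k) x) - G ((G ^^ k) x)) \<le> \<epsilon> * (M * ?r ^ k * norm x)"
      using close[of "(G ^^ k) x"] G_bound[of k] nonneg
      by (meson lessThan_iff mult_left_mono order_trans)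
    then show "norm ((F ^^ (n - 1 - k)) (F ((G ^^ k) x) - G ((G ^^ k) x)))
        \<le> M * q ^ (n - Suc k) * (\<epsilon> * (M * ?r ^ k * norm x))"
      using pow[of "n - Suc k" "F ((G ^^ k) x) - G ((G ^^ k) x)"] nonneg
      by (simp, meson mult_left_mono mult_nonneg_nonneg order_trans zero_le_power)
  qed
  also have "\<dots> = M * ((M * \<epsilon>) * (\<Sum>k<n. q ^ (n - Suc k) * ?r ^ k)) * norm x"
    by (simp add: sum_distrib_left sum_distrib_right mult_ac)
  also have "(M * \<epsilon>) * (\<Sum>k<n. q ^ (n - Suc k) * ?r ^ k) = ?r ^ n - q ^ n"
    using power_diff_sumr2[of ?r n q] by simp
  finally show ?case .
qed

lemma funpow_perturbation_linear:
  fixes F G :: "'a::real_normed_vector \<Rightarrow> 'a"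
  assumes F: "linear F"
    and pow: "\<And>k x. norm ((F ^^ k) x) \<le> M * q ^ k * norm x"
    and close: "\<And>x. norm (F x - G x) \<le> \<epsilon> * norm x"
    and nonneg: "M \<ge> 0" "q \<ge> 1" "\<epsilon> \<ge> 0"
  shows "norm ((F ^^ n) x - (G ^^ n) x) \<le> M\<^sup>2 * (real n * \<epsilon>) * (q + M * \<epsilon>) ^ n * norm x"
proof -
  let ?r = "q + M * \<epsilon>"
  have r: "q \<le> ?r" "?r \<ge> 1" using nonneg by (auto intro: add_increasing2)
  have "?r ^ n - q ^ n = (M * \<epsilon>) * (\<Sum>k<n. q ^ (n - Suc k) * ?r ^ k)"
    using power_diff_sumr2[of ?r n q] by simp
  also have "(\<Sum>k<n. q ^ (n - Suc k) * ?r ^ k) \<le> (\<Sum>k<n. ?r ^ n)"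
  proof (rule sum_mono)
    fix k assume k: "k \<in> {..<n}"
    have "q ^ (n - Suc k) * ?r ^ k \<le> ?r ^ (n - Suc k) * ?r ^ k"
      using r nonneg by (intro mult_right_mono power_mono) auto
    also have "\<dots> = ?r ^ (n - 1)" using k by (simp flip: power_add)
    also have "\<dots> \<le> ?r ^ n" using r by (intro power_increasing) auto
    finally show "q ^ (n - Suc k) * ?r ^ k \<le> ?r ^ n" .
  qed
  finally have diff: "?r ^ n - q ^ n \<le> (M * \<epsilon>) * (real n * ?r ^ n)"
    using nonneg by (simp add: mult_left_mono)
  have "norm ((F ^^ n) x - (G ^^ n) x) \<le> M * (?r ^ n - q ^ n) * norm x"
    by (rule funpow_perturbation[OF F pow close]) (use nonneg in auto)
  also have "\<dots> \<le> M * ((M * \<epsilon>) * (real n * ?r ^ n)) * norm x"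
    using diff nonneg by (intro mult_right_mono mult_left_mono) auto
  finally show ?thesis by (simp add: power2_eq_square mult_ac)
qed

text \<open>
  A Yosida distance below \<open>\<delta>\<close> says that the two Euler steps at \<open>\<mu>\<close> differ by at most \<open>\<delta> / \<mu>\<close> for large
  \<open>\<mu>\<close>. With \<open>n\<close> steps and \<open>\<mu> = n / t\<close> these errors add up to a multiple of \<open>\<delta> t\<close>, uniformly in \<open>n\<close>, and the
  exponential formula passes the bound to the semigroups. The bound involves the growth constants of \<open>T\<close>
  only; this is what makes a radius \<open>\<delta>\<close> possible that does not depend on \<open>S\<close>.
\<close>

theorem semigroup_distance_le:
  fixes T S :: "real \<Rightarrow> 'a::banach \<Rightarrow> 'a"
  assumes T: "growth_bounded_semigroup T M \<omega>"
    and S: "strongly_continuous_semigroup S"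
    and A: "generator_of T DA A" and B: "generator_of S DB B"
    and dist: "yosida_distance DA A DB B < ereal \<delta>" and \<delta>: "\<delta> \<ge> 0"
    and t: "t > 0"
  shows "norm (S t x - T t x) \<le> M\<^sup>2 * (\<delta> * t) * exp ((2 * \<omega> + M * \<delta>) * t) * norm x"
proof -
  interpret T: growth_bounded_semigroup T M \<omega> by (rule T)
  interpret S: strongly_continuous_semigroup S by (rule S)
  obtain M' \<omega>' where "M' \<ge> 1" "\<omega>' \<ge> 0" "\<And>t x. t \<ge> 0 \<Longrightarrow> norm (S t x) \<le> M' * exp (\<omega>' * t) * norm x"
    using S.growth_bound_exists by blast
  then interpret S: growth_bounded_semigroup S M' \<omega>' by unfold_locales
  have close: "norm (T.euler_step \<mu> x - S.euler_step \<mu> x) \<le> \<delta> / \<mu> * norm x"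
    if \<mu>: "\<mu> > \<omega>" "\<mu> > \<omega>'"
      and on: "onorm (\<lambda>x. yosida_approx DA A \<mu> x - yosida_approx DB B \<mu> x) < \<delta>" for \<mu> x
  proof -
    have pos: "\<mu> > 0" using \<mu> T.\<omega>_nonneg by simp
    let ?Y = "\<lambda>x. yosida_approx DA A \<mu> x - yosida_approx DB B \<mu> x"
    have Y: "?Y = (\<lambda>x. \<mu> *\<^sub>R (T.euler_step \<mu> x - S.euler_step \<mu> x))"
      by (simp add: yosida_approx_def T.resolvent_eq_laplace[OF A] S.resolvent_eq_laplace[OF B] \<mu>
          T.euler_step_def S.euler_step_def power2_eq_square algebra_simps)
    have "bounded_linear ?Y"
      unfolding Y using \<mu>
      by (intro bounded_linear_compose[OF bounded_linear_scaleR_right] bounded_linear_sub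
          T.bounded_linear_euler_step S.bounded_linear_euler_step)
    then have "norm (?Y x) \<le> onorm ?Y * norm x" by (rule onorm)
    also have "\<dots> \<le> \<delta> * norm x" using on by (intro mult_right_mono) auto
    finally have "norm (\<mu> *\<^sub>R (T.euler_step \<mu> x - S.euler_step \<mu> x)) \<le> \<delta> * norm x"
      unfolding fun_cong[OF Y, of x] .
    then have "\<mu> * norm (T.euler_step \<mu> x - S.euler_step \<mu> x) \<le> \<delta> * norm x"
      using pos by (simp only: norm_scaleR abs_of_pos)
    then show ?thesis using pos by (simp add: field_simps)
  qed
  have "\<forall>\<^sub>F \<mu> in at_top. ereal (onorm (\<lambda>x. yosida_approx DA A \<mu> x - yosida_approx DB B \<mu> x)) < ereal \<delta>"
    using dist unfolding yosida_distance_def by (rule Limsup_lessD)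
  then have "\<forall>\<^sub>F \<mu> in at_top. \<forall>x. norm (T.euler_step \<mu> x - S.euler_step \<mu> x) \<le> \<delta> / \<mu> * norm x"
    using eventually_gt_at_top[of \<omega>] eventually_gt_at_top[of \<omega>']
    by eventually_elim (intro allI close, simp_all)
  moreover have "filterlim (\<lambda>n. real n / t) at_top sequentially"
    using filterlim_tendsto_pos_mult_at_top[OF tendsto_const[of "1 / t"] _ filterlim_real_sequentially] t
    by simp
  ultimately have close_n: "\<forall>\<^sub>F n in sequentially. \<forall>x. norm (T.euler_step (real n / t) x - S.euler_step (real n / t) x)
      \<le> \<delta> / (real n / t) * norm x"
    by (rule eventually_compose_filterlim)
  have large: "\<forall>\<^sub>F n in sequentially. 2 * \<omega> * t \<le> real n \<and> n > 0"
    using eventually_ge_at_top[of "nat \<lceil>2 * \<omega> * t\<rceil>"] eventually_gt_at_top[of 0]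
    by eventually_elim (auto simp: nat_le_iff ceiling_le_iff)
  have "\<forall>\<^sub>F n in sequentially. norm ((T.euler_step (real n / t) ^^ n) x - (S.euler_step (real n / t) ^^ n) x)
      \<le> M\<^sup>2 * (\<delta> * t) * exp ((2 * \<omega> + M * \<delta>) * t) * norm x"
    using close_n large
  proof eventually_elim
    case (elim n)
    define \<mu> where "\<mu> = real n / t"
    have "\<omega> * t < n" using elim by auto
    then have \<mu>: "\<omega> < \<mu>" using t by (simp add: \<mu>_def field_simps)
    have "linear (T.euler_step \<mu>)"
      using T.bounded_linear_euler_step[OF \<mu>] by (rule bounded_linear.linear)
    moreover have "norm ((T.euler_step \<mu> ^^ k) y) \<le> M * (\<mu> / (\<mu> - \<omega>)) ^ k * norm y" for k y
      using T.euler_step_funpow_bound[OF \<mu>, of 0 k y] by (simp add: T.at_zero)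
    moreover have "norm (T.euler_step \<mu> y - S.euler_step \<mu> y) \<le> \<delta> / \<mu> * norm y" for y
      using elim by (simp add: \<mu>_def)
    moreover have "\<mu> / (\<mu> - \<omega>) \<ge> 1" "\<delta> / \<mu> \<ge> 0"
      using \<mu> \<delta> T.\<omega>_nonneg by (auto simp: field_simps)
    ultimately have "norm ((T.euler_step \<mu> ^^ n) x - (S.euler_step \<mu> ^^ n) x)
        \<le> M\<^sup>2 * (real n * (\<delta> / \<mu>)) * (\<mu> / (\<mu> - \<omega>) + M * (\<delta> / \<mu>)) ^ n * norm x"
      using T.M_ge_1 by (intro funpow_perturbation_linear) auto
    also have "real n * (\<delta> / \<mu>) = \<delta> * t" using elim by (simp add: \<mu>_def)
    also have "(\<mu> / (\<mu> - \<omega>) + M * (\<delta> / \<mu>)) ^ n \<le> exp ((2 * \<omega> + M * \<delta>) * t)"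
      using T.euler_step_power_le_exp[of t n "M * \<delta>"] elim t \<delta> T.M_ge_1
      by (simp add: \<mu>_def mult_ac)
    finally show ?case
      using \<delta> t by (simp add: \<mu>_def mult_left_mono mult_right_mono)
  qed
  moreover have "(\<lambda>n. norm ((T.euler_step (real n / t) ^^ n) x - (S.euler_step (real n / t) ^^ n) x))
      \<longlonglongrightarrow> norm (T t x - S t x)"
    by (intro tendsto_intros T.exponential_formula[OF A t] S.exponential_formula[OF B t])
  ultimately have "norm (T t x - S t x) \<le> M\<^sup>2 * (\<delta> * t) * exp ((2 * \<omega> + M * \<delta>) * t) * norm x"
    by (intro tendsto_upperbound) auto
  then show ?thesis by (simp add: norm_minus_commute)
qed

section \<open>Hyperbolicity through bounded impulse responses\<close>

text \<open>
  The bounded answer of the linear system \<open>u (n + 1) = L (u n)\<close>, in two-sided discrete time, to an impulse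
  \<open>x\<close> at time \<open>0\<close>. For a hyperbolic \<open>L\<close> it is the Green function: the stable part of \<open>x\<close> moves forward from
  time \<open>0\<close>, and minus its unstable part moves backward from time \<open>0\<close>.
\<close>

definition impulse_response :: "('a::real_normed_vector \<Rightarrow> 'a) \<Rightarrow> 'a \<Rightarrow> (int \<Rightarrow> 'a) \<Rightarrow> bool" where
  "impulse_response L x u \<longleftrightarrow>
     bounded (range u) \<and> (\<forall>n. u n = L (u (n - 1)) + (if n = 0 then x else 0))"

text \<open>
  For negative times the decay is counted from time \<open>-1\<close>, the last time before the impulse.
\<close>

definition has_decaying_responses :: "('a::real_normed_vector \<Rightarrow> 'a) \<Rightarrow> bool" where
  "has_decaying_responses L \<longleftrightarrow>
     (\<exists>C\<ge>0. \<forall>x. \<exists>u. impulse_response L x u \<and> (\<forall>v. impulse_response L x v \<longrightarrow> v = u) \<and>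
       (\<forall>k::nat. norm (u (int k)) \<le> C * (1/2) ^ k * norm x \<and>
                 norm (u (- 1 - int k)) \<le> C * (1/2) ^ k * norm x))"

text \<open>
  If the tail from \<open>k\<close> on is bounded by \<open>B\<close>, the inequality bounds the tail from \<open>k + 1\<close> on by
  \<open>3 * B / 6\<close>.
\<close>

lemma bounded_subaveraging_decay:
  fixes a :: "nat \<Rightarrow> real"
  assumes bound: "\<And>n. a n \<le> K"
    and sub: "\<And>n. a (Suc n) \<le> (a n + a (Suc n) + a (Suc (Suc n))) / 6"
  shows "a n \<le> K * (1/2) ^ n"
proof -
  have "\<forall>n\<ge>k. a n \<le> K * (1/2) ^ k" for k
  proof (induction k)
    case 0
    then show ?case using bound by simp
  next
    case (Suc k)
    show ?case
    proof (intro allI impI)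
      fix n assume "Suc k \<le> n"
      then obtain m where m: "n = Suc m" "k \<le> m" by (cases n) auto
      have "a m \<le> K * (1/2) ^ k" "a (Suc m) \<le> K * (1/2) ^ k" "a (Suc (Suc m)) \<le> K * (1/2) ^ k"
        using Suc m(2) by auto
      then show "a n \<le> K * (1/2) ^ Suc k"
        using sub[of m] m(1) by simp
    qed
  qed
  then show ?thesis by blast
qed

text \<open>
  Two-sided sequences coupled to their two neighbours, with coefficients whose norms add up to at most
  \<open>1/2\<close>. This makes the system a contraction for the supremum norm. The same smallness
  makes bounded solutions decay along a half-line without forcing.
\<close>

locale tridiagonal_contraction =
  fixes G\<^sub>1 G\<^sub>2 G\<^sub>3 :: "'a::banach \<Rightarrow> 'a"
  assumes lin: "bounded_linear G\<^sub>1" "bounded_linear G\<^sub>2" "bounded_linear G\<^sub>3"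
    and contr: "norm (G\<^sub>1 x) \<le> norm x / 6" "norm (G\<^sub>2 x) \<le> norm x / 6" "norm (G\<^sub>3 x) \<le> norm x / 6"
begin

definition solution :: "(int \<Rightarrow> 'a) \<Rightarrow> (int \<Rightarrow> 'a) \<Rightarrow> bool" where
  "solution c u \<longleftrightarrow> (\<forall>n. u n = c n + G\<^sub>1 (u (n - 1)) + G\<^sub>2 (u n) + G\<^sub>3 (u (n + 1)))"

lemma solution_exists:
  assumes c: "\<And>n. norm (c n) \<le> K"
  obtains u where "solution c u" "\<And>n. norm (u n) \<le> 2 * K"
proof -
  \<comment> \<open>The terms of the Neumann series, formed pointwise in the time \<open>n\<close>.\<close>
  define v where "v = rec_nat c (\<lambda>_ w n. G\<^sub>1 (w (n - 1)) + G\<^sub>2 (w n) + G\<^sub>3 (w (n + 1)))"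
  have v0: "v 0 = c"
    and vS: "v (Suc k) n = G\<^sub>1 (v k (n - 1)) + G\<^sub>2 (v k n) + G\<^sub>3 (v k (n + 1))" for k n
    by (simp_all add: v_def)
  have v_bound: "norm (v k n) \<le> K * (1/2) ^ k" for k n
  proof (induction k arbitrary: n)
    case 0
    then show ?case using c v0 by simp
  next
    case (Suc k)
    have "norm (v (Suc k) n) \<le> norm (G\<^sub>1 (v k (n - 1))) + norm (G\<^sub>2 (v k n)) + norm (G\<^sub>3 (v k (n + 1)))"
      unfolding vS by (metis norm_triangle_mono norm_triangle_ineq order_refl)
    also have "\<dots> \<le> (norm (v k (n - 1)) + norm (v k n) + norm (v k (n + 1))) / 6"
      using contr(1)[of "v k (n - 1)"] contr(2)[of "v k n"] contr(3)[of "v k (n + 1)"] by simp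
    also have "\<dots> \<le> K * (1/2) ^ Suc k"
      using Suc[of "n - 1"] Suc[of n] Suc[of "n + 1"] by simp
    finally show ?case .
  qed
  have geo: "(\<lambda>k. K * (1/2) ^ k) sums (2 * K)"
    using sums_mult[OF geometric_sums[of "1/2 :: real"], of K] by (simp add: mult.commute)
  have sm: "summable (\<lambda>k. v k n)" for n
    by (rule summable_comparison_test'[OF sums_summable[OF geo], of 0]) (use v_bound in auto)
  define u where "u n = (\<Sum>k. v k n)" for n
  have "norm (u n) \<le> 2 * K" for n
  proof -
    have "norm (u n) \<le> (\<Sum>k. K * (1/2) ^ k)"
      unfolding u_def by (intro norm_suminf_le sums_summable[OF geo] v_bound)
    then show ?thesis using sums_unique[OF geo] by simp
  qed
  moreover have "solution c u"
    unfolding solution_def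
  proof
    fix n
    have "u n = v 0 n + (\<Sum>k. v (Suc k) n)"
      unfolding u_def using suminf_split_head[OF sm[of n]] by simp
    also have "(\<Sum>k. v (Suc k) n) = G\<^sub>1 (u (n - 1)) + G\<^sub>2 (u n) + G\<^sub>3 (u (n + 1))"
    proof -
      note s = bounded_linear.summable[OF lin(1) sm[of "n - 1"]] bounded_linear.summable[OF lin(2) sm[of n]]
        bounded_linear.summable[OF lin(3) sm[of "n + 1"]]
      show ?thesis
        unfolding vS u_def suminf_add[OF summable_add[OF s(1,2)] s(3), symmetric]
          suminf_add[OF s(1,2), symmetric]
        by (simp only: bounded_linear.suminf[OF lin(1) sm] bounded_linear.suminf[OF lin(2) sm]
            bounded_linear.suminf[OF lin(3) sm])
    qed
    finally show "u n = c n + G\<^sub>1 (u (n - 1)) + G\<^sub>2 (u n) + G\<^sub>3 (u (n + 1))"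
      by (simp add: v0 add.assoc)
  qed
  ultimately show ?thesis using that by blast
qed

lemma solution_subaveraging:
  assumes "solution c u" "c n = 0"
  shows "norm (u n) \<le> (norm (u (n - 1)) + norm (u n) + norm (u (n + 1))) / 6"
proof -
  have "u n = G\<^sub>1 (u (n - 1)) + G\<^sub>2 (u n) + G\<^sub>3 (u (n + 1))"
    using assms(1)[unfolded solution_def, rule_format, of n] assms(2) by simp
  then have "norm (u n) \<le> norm (G\<^sub>1 (u (n - 1))) + norm (G\<^sub>2 (u n)) + norm (G\<^sub>3 (u (n + 1)))"
    by (metis norm_triangle_mono norm_triangle_ineq order_refl)
  then show ?thesis
    using contr(1)[of "u (n - 1)"] contr(2)[of "u n"] contr(3)[of "u (n + 1)"] by simp
qed

lemma solution_decay_right: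
  assumes "solution c u" "\<And>n. norm (u n) \<le> K" "\<And>n. n > m \<Longrightarrow> c n = 0"
  shows "norm (u (m + int k)) \<le> K * (1/2) ^ k"
proof (rule bounded_subaveraging_decay)
  fix n
  show "norm (u (m + int (Suc n)))
      \<le> (norm (u (m + int n)) + norm (u (m + int (Suc n))) + norm (u (m + int (Suc (Suc n))))) / 6"
    using solution_subaveraging[OF assms(1), of "m + int (Suc n)"] assms(3) by (simp add: algebra_simps)
qed (rule assms(2))

lemma solution_decay_left:
  assumes "solution c u" "\<And>n. norm (u n) \<le> K" "\<And>n. n < m \<Longrightarrow> c n = 0"
  shows "norm (u (m - int k)) \<le> K * (1/2) ^ k"
proof (rule bounded_subaveraging_decay)
  fix n
  show "norm (u (m - int (Suc n)))
      \<le> (norm (u (m - int n)) + norm (u (m - int (Suc n))) + norm (u (m - int (Suc (Suc n))))) / 6"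
    using solution_subaveraging[OF assms(1), of "m - int (Suc n)"] assms(3) by (simp add: algebra_simps)
qed (rule assms(2))

text \<open>
  The difference of two bounded solutions is unforced everywhere, so the decay estimate may be started
  arbitrarily far to the left of a given time.
\<close>

lemma solution_unique:
  assumes u: "solution c u" "bounded (range u)" and v: "solution c v" "bounded (range v)"
  shows "u = v"
proof
  fix n
  define d where "d n = u n - v n" for n
  obtain B\<^sub>1 B\<^sub>2 where "\<And>n. norm (u n) \<le> B\<^sub>1" "\<And>n. norm (v n) \<le> B\<^sub>2"
    using assms(2,4) by (auto simp: bounded_iff)
  then have K: "norm (d m) \<le> B\<^sub>1 + B\<^sub>2" for m
    unfolding d_def by (meson norm_triangle_ineq4 add_mono order_trans)
  have d: "solution (\<lambda>_. 0) d"
    unfolding solution_def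
  proof
    fix m
    interpret G1: bounded_linear G\<^sub>1 by (rule lin)
    interpret G2: bounded_linear G\<^sub>2 by (rule lin)
    interpret G3: bounded_linear G\<^sub>3 by (rule lin)
    show "d m = 0 + G\<^sub>1 (d (m - 1)) + G\<^sub>2 (d m) + G\<^sub>3 (d (m + 1))"
      using arg_cong2[OF u(1)[unfolded solution_def, rule_format, of m]
          v(1)[unfolded solution_def, rule_format, of m], of minus]
      unfolding d_def G1.diff G2.diff G3.diff by (simp add: algebra_simps)
  qed
  have "norm (d n) \<le> (B\<^sub>1 + B\<^sub>2) * (1/2) ^ k" for k
    using solution_decay_right[OF d K, of "n - int k" k] by simp
  moreover have "(\<lambda>k. (B\<^sub>1 + B\<^sub>2) * (1/2::real) ^ k) \<longlonglongrightarrow> 0"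
    by (intro tendsto_mult_right_zero LIMSEQ_power_zero) simp
  ultimately have "norm (d n) \<le> 0"
    by (intro tendsto_lowerbound[of _ 0 sequentially "norm (d n)"]) auto
  then show "u n = v n" by (simp add: d_def)
qed

end

text \<open>
  Here \<open>W\<close> is the inverse of \<open>L\<close> on the kernel of \<open>P\<close>, composed with the complementary projection. The
  stable part of the recursion for \<open>L'\<close> is kept and read forward in time; the unstable part is solved for
  the earlier value by means of \<open>W\<close>. In this form all coefficients are small, for \<open>L'\<close> close to a strongly
  hyperbolic \<open>L\<close>, and the recursion becomes a tridiagonal contraction.
\<close>

theorem has_decaying_responses_perturbation:
  fixes L L' P W :: "'a::banach \<Rightarrow> 'a"
  assumes lin: "bounded_linear L" "bounded_linear L'" "bounded_linear P" "bounded_linear W"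
    and idem: "\<And>x. P (P x) = P x" and comm: "\<And>x. L (P x) = P (L x)"
    and PW: "\<And>x. P (W x) = 0" and LW: "\<And>x. L (W x) = x - P x" and WL: "\<And>x. W (L x) = x - P x"
    and PL': "\<And>x. norm (P (L' x)) \<le> norm x / 6"
    and W: "\<And>x. norm (W x) \<le> norm x / 6"
    and W': "\<And>x. norm (W (L' x - L x)) \<le> norm x / 6"
  shows "has_decaying_responses L'"
proof -
  interpret L: bounded_linear L by (rule lin)
  interpret L': bounded_linear L' by (rule lin)
  interpret P: bounded_linear P by (rule lin)
  interpret W: bounded_linear W by (rule lin)
  interpret tridiagonal_contraction "\<lambda>x. P (L' x)" "\<lambda>x. - W (L' x - L x)" W
  proof (rule tridiagonal_contraction.intro)
    show "bounded_linear (\<lambda>x. P (L' x))" by (rule bounded_linear_compose) (rule lin)+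
    show "bounded_linear (\<lambda>x. - W (L' x - L x))"
      by (intro bounded_linear_minus bounded_linear_compose[OF lin(4)] bounded_linear_sub lin)
  qed (use lin PL' W W' in auto)
  have iff: "(\<forall>n. u n = L' (u (n - 1)) + f n) \<longleftrightarrow> solution (\<lambda>n. P (f n) - W (f (n + 1))) u" for u f
  proof -
    have expand: "P (f n) - W (f (n + 1)) + P (L' (u (n - 1))) + - W (L' (u n) - L (u n)) + W (u (n + 1))
        = P (L' (u (n - 1)) + f n) + W (u (n + 1) - L' (u n) - f (n + 1) + L (u n))" for n
      by (simp add: P.add W.add W.diff)
    show ?thesis
      unfolding solution_def expand
    proof
      assume *: "\<forall>n. u n = L' (u (n - 1)) + f n"
      show "\<forall>n. u n = P (L' (u (n - 1)) + f n) + W (u (n + 1) - L' (u n) - f (n + 1) + L (u n))"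
      proof
        fix n
        have "u (n + 1) - L' (u n) - f (n + 1) + L (u n) = L (u n)"
          using *[rule_format, of "n + 1"] by simp
        moreover have "L' (u (n - 1)) + f n = u n" using *[rule_format, of n] by simp
        ultimately show "u n = P (L' (u (n - 1)) + f n) + W (u (n + 1) - L' (u n) - f (n + 1) + L (u n))"
          by (simp add: WL)
      qed
    next
      assume *: "\<forall>n. u n = P (L' (u (n - 1)) + f n) + W (u (n + 1) - L' (u n) - f (n + 1) + L (u n))"
      have stable: "P (u n) = P (L' (u (n - 1)) + f n)" for n
        using arg_cong[OF *[rule_format, of n], of P] by (simp add: P.add P.diff PW idem)
      \<comment> \<open>The rearranged equation at time \<open>n - 1\<close> determines the unstable part at time \<open>n\<close>.\<close>
      have unstable: "u n - P (u n) = L' (u (n - 1)) + f n - P (L' (u (n - 1)) + f n)" for n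
      proof -
        let ?m = "n - 1"
        define r where "r = u n - L' (u ?m) - f n + L (u ?m)"
        have "u ?m = P (u ?m) + W r"
          using *[rule_format, of ?m] unfolding stable[of ?m, symmetric] by (simp add: r_def)
        then have "u ?m - P (u ?m) = W r" by (metis add_diff_cancel_left')
        then have "L (u ?m) - P (L (u ?m)) = r - P r"
          by (metis L.diff LW comm)
        then show ?thesis by (simp add: r_def P.add P.diff algebra_simps)
      qed
      show "\<forall>n. u n = L' (u (n - 1)) + f n"
        using stable unstable by (metis diff_add_cancel)
    qed
  qed
  define c where "c x = (\<lambda>n::int. P (if n = 0 then x else 0) - W (if n + 1 = 0 then x else 0))" for x
  have response: "impulse_response L' x u \<longleftrightarrow> bounded (range u) \<and> solution (c x) u" for x u
    using iff[of u "\<lambda>n. if n = 0 then x else 0"] by (simp only: impulse_response_def c_def)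
  obtain p where p: "p \<ge> 0" "\<And>x. norm (P x) \<le> norm x * p"
    using P.nonneg_bounded by blast
  have c_bound: "norm (c x n) \<le> (p + 1) * norm x" for x n
  proof -
    have "norm (c x n) \<le> norm x * p + norm x / 6"
      using p(2)[of x] W[of x] p(1) by (auto simp: c_def P.zero W.zero add_increasing add_increasing2)
    moreover have "(p + 1) * norm x = norm x * p + norm x" by (simp add: algebra_simps)
    ultimately show ?thesis using norm_ge_zero[of x] by linarith
  qed
  show ?thesis
    unfolding has_decaying_responses_def
  proof (intro exI[of _ "2 * (p + 1)"] conjI allI)
    fix x
    obtain u where u: "solution (c x) u" "\<And>n. norm (u n) \<le> 2 * ((p + 1) * norm x)"
      using solution_exists[of "c x", OF c_bound] by blast
    have bd: "bounded (range u)" using u(2) by (auto simp: bounded_iff)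
    have c0: "c x n = 0" if "n \<noteq> 0" "n \<noteq> - 1" for n
      using that by (simp add: c_def P.zero W.zero)
    show "\<exists>u. impulse_response L' x u \<and> (\<forall>v. impulse_response L' x v \<longrightarrow> v = u) \<and>
       (\<forall>k::nat. norm (u (int k)) \<le> 2 * (p + 1) * (1/2) ^ k * norm x \<and>
                 norm (u (- 1 - int k)) \<le> 2 * (p + 1) * (1/2) ^ k * norm x)"
    proof (intro exI[of _ u] conjI allI impI)
      show "impulse_response L' x u" using u bd response by simp
      show "v = u" if "impulse_response L' x v" for v
        using that u(1) bd response solution_unique by blast
      show "norm (u (int k)) \<le> 2 * (p + 1) * (1/2) ^ k * norm x" for k
        using solution_decay_right[OF u, of 0 k] c0 by (simp add: algebra_simps)
      show "norm (u (- 1 - int k)) \<le> 2 * (p + 1) * (1/2) ^ k * norm x" for k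
        using solution_decay_left[OF u, of "- 1" k] c0 by (simp add: algebra_simps)
    qed
  qed (use p in simp)
qed

section \<open>The dichotomy of a semigroup from the responses of one of its operators\<close>

lemma C0_semigroup_strongly_continuous:
  "C0_semigroup smul T \<Longrightarrow> strongly_continuous_semigroup T"
  unfolding C0_semigroup_def bounded_operator_def
  by (intro strongly_continuous_semigroup.intro) (blast | simp)+

text \<open>
  Together with uniqueness of responses, this makes the projection built from them commute with every
  operator that commutes with \<open>L\<close>: the semigroup, and the scalars.
\<close>

lemma impulse_response_compose:
  assumes u: "impulse_response L x u" and F: "bounded_linear F" and comm: "\<And>x. F (L x) = L (F x)"
  shows "impulse_response L (F x) (\<lambda>n. F (u n))"
proof -
  interpret bounded_linear F by (rule F)
  have "bounded (F ` range u)" 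
    using u F unfolding impulse_response_def by (blast intro: bounded_linear_image)
  moreover have "F (u n) = L (F (u (n - 1))) + (if n = 0 then F x else 0)" for n
  proof -
    have "F (u n) = F (L (u (n - 1)) + (if n = 0 then x else 0))"
      using u unfolding impulse_response_def by metis
    then show ?thesis by (simp add: comm add)
  qed
  ultimately show ?thesis unfolding impulse_response_def image_image by blast
qed

text \<open>
  The projection \<open>Q\<close> sends \<open>x\<close> to the value at time \<open>0\<close> of its response. Its range consists of the points
  with bounded forward orbit, and its kernel of those that are reached by a bounded backward orbit; the
  decay of the response is the required estimate at multiples of \<open>\<tau>\<close>. Its algebraic properties all come
  from uniqueness: a sequence is exhibited that solves the system, so it is the response. Times
  that are not multiples of \<open>\<tau>\<close> are handled by one more semigroup operator at a time in \<open>[0, \<tau>]\<close>.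
\<close>

theorem exponential_dichotomy_of_responses:
  fixes smul :: "'k::real_normed_field \<Rightarrow> 'a::banach \<Rightarrow> 'a"
  assumes sp: "banach_over smul" and C0: "C0_semigroup smul S"
    and \<tau>: "\<tau> > 0" and resp: "has_decaying_responses (S \<tau>)"
  shows "exponential_dichotomy smul S"
proof -
  interpret banach_over smul by (rule sp)
  interpret strongly_continuous_semigroup S by (rule C0_semigroup_strongly_continuous[OF C0])
  have smul_S: "S t (smul c x) = smul c (S t x)" if "t \<ge> 0" for t c x
  proof -
    have "Vector_Spaces.linear smul smul (S t)"
      using C0 that unfolding C0_semigroup_def bounded_operator_def by blast
    then show ?thesis by (simp add: Vector_Spaces.linear_iff)
  qed
  define L where "L = S \<tau>"
  interpret L: bounded_linear L unfolding L_def by (rule bounded_linear_op) (use \<tau> in simp)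
  have comm: "S t (L x) = L (S t x)" if "t \<ge> 0" for t x
    unfolding L_def using that \<tau> by (intro commute) auto
  define decaying_response where "decaying_response C x u \<longleftrightarrow> impulse_response L x u \<and> (\<forall>v. impulse_response L x v \<longrightarrow> v = u) \<and>
       (\<forall>k::nat. norm (u (int k)) \<le> C * (1/2) ^ k * norm x \<and>
                 norm (u (- 1 - int k)) \<le> C * (1/2) ^ k * norm x)" for C x u
  have "\<exists>C\<ge>0. \<forall>x. \<exists>u. decaying_response C x u"
    using resp unfolding has_decaying_responses_def L_def decaying_response_def .
  then obtain C where C: "C \<ge> 0" and "\<forall>x. \<exists>u. decaying_response C x u" by blast
  then obtain u where decaying_response: "\<And>x. decaying_response C x (u x)"
    using choice by blast
  have u: "impulse_response L x (u x)"
    and uniq: "impulse_response L x v \<Longrightarrow> v = u x"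
    and right: "norm (u x (int k)) \<le> C * (1/2) ^ k * norm x"
    and left: "norm (u x (- 1 - int k)) \<le> C * (1/2) ^ k * norm x" for x k v
    using decaying_response[of x] unfolding decaying_response_def by blast+
  have u_bounded: "bounded (range (u x))" for x
    by (rule u[unfolded impulse_response_def, THEN conjunct1])
  have u_rec: "u x n = L (u x (n - 1)) + (if n = 0 then x else 0)" for x n
    by (rule u[unfolded impulse_response_def, THEN conjunct2, rule_format])
  define Q where "Q x = u x 0" for x
  define Ker where "Ker = {x. Q x = 0}"

  have Q_add: "Q (x + y) = Q x + Q y" for x y
  proof -
    have "u x n + u y n = L (u x (n - 1) + u y (n - 1)) + (if n = 0 then x + y else 0)" for n
      using arg_cong2[OF u_rec[of x n] u_rec[of y n], of plus] by (simp add: L.add add_ac)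
    then have "impulse_response L (x + y) (\<lambda>n. u x n + u y n)"
      unfolding impulse_response_def
      by (intro conjI allI bounded_plus_comp u_bounded)
    from fun_cong[OF uniq[OF this], of 0] show ?thesis by (simp add: Q_def)
  qed
  have Q_smul: "Q (smul c x) = smul c (Q x)" for c x
  proof -
    have "bounded_linear (smul c)"
    proof (rule bounded_linear_intro[where K = "norm c"])
      show "smul c (x + y) = smul c x + smul c y" for x y by (rule scale_right_distrib)
      show "smul c (r *\<^sub>R x) = r *\<^sub>R smul c x" for r x
        by (simp add: smul_of_real[symmetric] mult.commute)
      show "norm (smul c x) \<le> norm x * norm c" for x by (simp add: norm_smul mult.commute)
    qed
    moreover have "smul c (L y) = L (smul c y)" for y
      unfolding L_def by (rule smul_S[symmetric]) (use \<tau> in simp)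
    ultimately have "impulse_response L (smul c x) (\<lambda>n. smul c (u x n))"
      by (rule impulse_response_compose[OF u])
    from fun_cong[OF uniq[OF this], of 0] show ?thesis by (simp add: Q_def)
  qed
  have Q_scaleR: "Q (r *\<^sub>R x) = r *\<^sub>R Q x" for r x
    using Q_smul[of "of_real r"] by (simp add: smul_of_real)
  have "bounded_linear Q"
  proof (rule bounded_linear_intro[where K = C])
    show "norm (Q x) \<le> norm x * C" for x
      using right[of x 0] by (simp add: Q_def mult.commute)
  qed (rule Q_add Q_scaleR)+
  then interpret Q: bounded_linear Q .
  have Q_op: "bounded_operator smul Q"
    unfolding bounded_operator_def Vector_Spaces.linear_iff
    using \<open>bounded_linear Q\<close> Q_add Q_smul vector_space_axioms by auto
  have Q_S: "Q (S t x) = S t (Q x)" if "t \<ge> 0" for t x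
  proof -
    have "impulse_response L (S t x) (\<lambda>n. S t (u x n))"
      by (rule impulse_response_compose[where F = "S t", OF u bounded_linear_op comm]) (rule that)+
    from fun_cong[OF uniq[OF this], of 0] show ?thesis by (simp add: Q_def)
  qed
  \<comment> \<open>A bounded forward orbit of \<open>x\<close>, extended by \<open>0\<close> to the past, is the response to \<open>x\<close>.\<close>
  have Q_eqI: "Q x = x" if v: "v 0 = x" "\<And>k. v (Suc k) = L (v k)" "bounded (range v)" for x v
  proof -
    define w where "w n = (if n \<ge> 0 then v (nat n) else 0)" for n :: int
    have "w n = L (w (n - 1)) + (if n = 0 then x else 0)" for n
    proof -
      consider "n < 0" | "n = 0" | "n > 0" by linarith
      then show ?thesis
      proof cases
        case 3
        then have "nat n = Suc (nat (n - 1))" by simp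
        then show ?thesis using 3 v(2)[of "nat (n - 1)"] by (simp add: w_def)
      qed (simp_all add: w_def v L.zero)
    qed
    moreover have "range w \<subseteq> insert 0 (range v)" by (auto simp: w_def)
    then have "bounded (range w)" using v(3) by (metis bounded_insert bounded_subset)
    ultimately have "impulse_response L x w" unfolding impulse_response_def by blast
    from fun_cong[OF uniq[OF this], of 0] show ?thesis by (simp add: Q_def w_def v(1))
  qed
  have u_forward: "u x (int (Suc k)) = L (u x (int k))" for x k
    using u_rec[of x "int (Suc k)"] by simp
  have u_forward_eq: "u x (int k) = S (real k * \<tau>) (Q x)" for x k
  proof (induction k)
    case 0
    then show ?case by (simp add: Q_def at_zero)
  next
    case (Suc k)
    then show ?case
      unfolding u_forward using \<tau> semigroup[of \<tau> "real k * \<tau>"] by (simp add: L_def algebra_simps)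
  qed
  have idem: "Q (Q x) = Q x" for x
  proof (rule Q_eqI[where v = "\<lambda>k. u x (int k)"])
    show "bounded (range (\<lambda>k. u x (int k)))"
      by (rule bounded_subset[OF u_bounded[of x]]) auto
  qed (use u_forward in \<open>auto simp: Q_def\<close>)

  obtain M \<omega> where M: "M \<ge> 1" "\<omega> \<ge> 0" "\<And>t x. t \<ge> 0 \<Longrightarrow> norm (S t x) \<le> M * exp (\<omega> * t) * norm x"
    using growth_bound_exists by blast
  define K where "K = M * exp (\<omega> * \<tau>)"
  have K: "K > 0" "\<And>t x. 0 \<le> t \<Longrightarrow> t \<le> \<tau> \<Longrightarrow> norm (S t x) \<le> K * norm x"
  proof -
    show "K > 0" using M(1) by (simp add: K_def)
    fix t x assume t: "0 \<le> t" "t \<le> \<tau>"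
    have "norm (S t x) \<le> M * exp (\<omega> * t) * norm x" using M t by simp
    also have "\<dots> \<le> K * norm x"
      unfolding K_def using t M by (intro mult_right_mono) (auto intro: mult_left_mono)
    finally show "norm (S t x) \<le> K * norm x" .
  qed
  \<comment> \<open>The bound on the response halves at each step, and one step takes the time \<open>\<tau>\<close>.\<close>
  define \<beta> where "\<beta> = ln 2 / \<tau>"
  have \<beta>: "\<beta> > 0" using \<tau> by (simp add: \<beta>_def)
  define N where "N = K * (C + 1) * 2"
  have N: "N > 0" using K(1) C by (simp add: N_def)
  \<comment> \<open>The factor \<open>2\<close> pays for rounding \<open>t\<close> down to a multiple of \<open>\<tau>\<close>.\<close>
  have steps: "\<exists>k. real k * \<tau> \<le> t \<and> t \<le> real (Suc k) * \<tau> \<and> (1/2) ^ k \<le> 2 * exp (- \<beta> * t)" if "t \<ge> 0" for t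
  proof -
    define k where "k = nat \<lfloor>t / \<tau>\<rfloor>"
    have "real k = of_int \<lfloor>t / \<tau>\<rfloor>" using that \<tau> by (simp add: k_def)
    then have "real k \<le> t / \<tau>" "t / \<tau> \<le> real k + 1" by linarith+
    then have k: "real k * \<tau> \<le> t" "t \<le> real (Suc k) * \<tau>" using \<tau> by (auto simp: field_simps)
    have "exp (- \<beta> * (real (Suc k) * \<tau>)) = (1/2) ^ Suc k"
    proof -
      have "- \<beta> * (real (Suc k) * \<tau>) = real (Suc k) * ln (1/2)"
        using \<tau> by (simp add: \<beta>_def ln_div)
      then show ?thesis by (simp only: exp_of_nat_mult) simp
    qed
    then have "(1/2) ^ k = 2 * exp (- \<beta> * (real (Suc k) * \<tau>))" by simp
    also have "\<dots> \<le> 2 * exp (- \<beta> * t)"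
      using k(2) \<beta> by simp
    finally show ?thesis using k by blast
  qed
  have estimate: "norm (S s y) \<le> N * exp (- \<beta> * t) * norm x"
    if "norm y \<le> C * (1/2) ^ k * norm x" "(1/2) ^ k \<le> 2 * exp (- \<beta> * t)" "0 \<le> s" "s \<le> \<tau>" for s y t k x
  proof -
    have "norm (S s y) \<le> K * norm y" using that by (intro K)
    also have "\<dots> \<le> K * (C * (1/2) ^ k * norm x)" using that K by (intro mult_left_mono) auto
    also have "\<dots> \<le> K * ((C + 1) * (2 * exp (- \<beta> * t)) * norm x)"
      using that K C by (intro mult_left_mono mult_right_mono mult_mono) auto
    finally show ?thesis by (simp add: N_def algebra_simps)
  qed

  have stable: "norm (S t x) \<le> N * exp (- \<beta> * t) * norm x" if t: "t \<ge> 0" and "x \<in> range Q" for t x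
  proof -
    obtain k where k: "real k * \<tau> \<le> t" "t \<le> real (Suc k) * \<tau>" "(1/2) ^ k \<le> 2 * exp (- \<beta> * t)"
      using steps[OF t] by blast
    have "Q x = x" using that idem by auto
    then have "S t x = S (t - real k * \<tau>) (u x (int k))"
      using semigroup[of "t - real k * \<tau>" "real k * \<tau>" x] k \<tau> by (simp add: u_forward_eq)
    then show ?thesis using estimate[OF right k(3)] k by (simp add: algebra_simps)
  qed

  \<comment> \<open>For \<open>x\<close> in the kernel the response vanishes at time \<open>0\<close>, so that minus its past is a backward
    orbit of \<open>x\<close>.\<close>
  have u_backward: "S (real (Suc j) * \<tau>) (u x (- 1 - int j)) = - x" if "x \<in> Ker" for x j
  proof (induction j)
    case 0
    have "0 = L (u x (- 1)) + x"
      using u_rec[of x 0] that by (simp add: Ker_def Q_def)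
    then show ?case by (simp add: L_def eq_neg_iff_add_eq_0)
  next
    case (Suc j)
    have "u x (- 1 - int j) = L (u x (- 1 - int (Suc j)))"
      using u_rec[of x "- 1 - int j"] by (simp add: algebra_simps)
    then show ?case
      using Suc semigroup[of "real (Suc j) * \<tau>" \<tau> "u x (- 1 - int (Suc j))"] \<tau>
      by (simp add: L_def algebra_simps)
  qed
  have u_backward_Ker: "u x (- 1 - int j) \<in> Ker" if x: "x \<in> Ker" for x j
  proof -
    let ?m = "- 1 - int j"
    \<comment> \<open>Minus the past of the response before time \<open>?m\<close>, moved to end at time \<open>0\<close>, answers to the value at \<open>?m\<close>
      and is zero from time \<open>0\<close> on.\<close>
    define w where "w n = (if n \<ge> 0 then 0 else - u x (n + ?m))" for n :: int
    have "w n = L (w (n - 1)) + (if n = 0 then u x ?m else 0)" for n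
    proof -
      consider "n < 0" | "n = 0" | "n > 0" by linarith
      then show ?thesis
      proof cases
        case 1
        then show ?thesis using u_rec[of x "n + ?m"] by (simp add: w_def L.neg algebra_simps)
      next
        case 2
        have arg: "n - 1 + ?m = ?m - 1" using 2 by simp
        have "w (n - 1) = - u x (?m - 1)" unfolding arg[symmetric] using 2 by (simp add: w_def)
        moreover have "u x ?m = L (u x (?m - 1))" using u_rec[of x ?m] by simp
        moreover have "w n = 0" using 2 by (simp add: w_def)
        ultimately show ?thesis using 2 by (simp only: L.neg) simp
      qed (simp add: w_def L.zero)
    qed
    moreover have "range w \<subseteq> insert 0 (uminus ` range (u x))" by (auto simp: w_def)
    then have "bounded (range w)"
      by (rule bounded_subset[rotated]) (use u_bounded[of x] in \<open>simp add: bounded_insert bounded_uminus\<close>)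
    ultimately have "impulse_response L (u x ?m) w" unfolding impulse_response_def by blast
    from fun_cong[OF uniq[OF this], of 0] have "Q (u x ?m) = w 0" by (simp add: Q_def)
    then show ?thesis by (simp add: w_def Ker_def)
  qed

  have backward: "\<exists>y\<in>Ker. S t y = x \<and> norm y \<le> N * exp (- \<beta> * t) * norm x"
    if t: "t \<ge> 0" and x: "x \<in> Ker" for t x
  proof -
    obtain k where k: "real k * \<tau> \<le> t" "t \<le> real (Suc k) * \<tau>" "(1/2) ^ k \<le> 2 * exp (- \<beta> * t)"
      using steps[OF t] by blast
    \<comment> \<open>Go back to the multiple \<open>(k + 1) \<tau>\<close>, at or beyond \<open>t\<close>, then forward by the excess \<open>s\<close>.\<close>
    define s where "s = real (Suc k) * \<tau> - t"
    have s: "0 \<le> s" "s \<le> \<tau>" "t + s = real (Suc k) * \<tau>" using k by (auto simp: s_def algebra_simps)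
    interpret Ss: bounded_linear "S s" by (rule bounded_linear_op) fact
    interpret St: bounded_linear "S t" by (rule bounded_linear_op) fact
    define z where "z = u x (- 1 - int k)"
    have "Q (S s (- z)) = 0"
      using u_backward_Ker[OF x, of k] s by (simp add: Q_S Ker_def z_def Ss.neg Q.neg Ss.zero)
    then have "S s (- z) \<in> Ker" by (simp add: Ker_def)
    moreover have "S t (S s (- z)) = x"
    proof -
      have "S t (S s z) = - x"
        using semigroup[OF t s(1), of z] u_backward[OF x, of k] s by (simp add: z_def)
      then show ?thesis by (simp add: Ss.neg St.neg)
    qed
    moreover have "norm (S s (- z)) \<le> N * exp (- \<beta> * t) * norm x"
      using left[of x k] by (intro estimate[OF _ k(3) s(1,2)]) (simp add: z_def)
    ultimately show ?thesis by blast
  qed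

  \<comment> \<open>An orbit that reaches \<open>0\<close> stays there; it is bounded, which puts \<open>x\<close> into the range of \<open>Q\<close> as well.\<close>
  have kernel_trivial: "x = 0" if t: "t \<ge> 0" and x: "x \<in> Ker" and zero: "S t x = 0" for t x
  proof -
    define v where "v k = S (real k * \<tau>) x" for k
    obtain m where m: "t / \<tau> \<le> real m" using real_arch_simple by blast
    have "v k = 0" if "k \<ge> m" for k
    proof -
      have "t \<le> real m * \<tau>" using m \<tau> by (simp add: field_simps)
      also have "\<dots> \<le> real k * \<tau>" using that \<tau> by simp
      finally have le: "t \<le> real k * \<tau>" .
      then have "v k = S (real k * \<tau> - t) (S t x)"
        using semigroup[of "real k * \<tau> - t" t x] t by (simp add: v_def)
      then show ?thesis
        using zero bounded_linear_op[of "real k * \<tau> - t"] le by (simp add: linear_simps)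
    qed
    then have "v k \<in> insert 0 (v ` {..<m})" for k
      by (cases "k < m") (auto simp: not_less)
    then have "range v \<subseteq> insert 0 (v ` {..<m})" by blast
    then have "bounded (range v)" by (rule bounded_subset[rotated]) (simp add: finite_imp_bounded)
    moreover have "v (Suc k) = L (v k)" for k
      using semigroup[of \<tau> "real k * \<tau>" x] \<tau> by (simp add: v_def L_def algebra_simps)
    ultimately have "Q x = x" by (intro Q_eqI[where v = v]) (simp_all add: v_def at_zero)
    then show ?thesis using x by (simp add: Ker_def)
  qed
  have inj: "inj_on (S t) Ker" if "t \<ge> 0" for t
  proof (rule inj_onI)
    fix x y assume xy: "x \<in> Ker" "y \<in> Ker" "S t x = S t y"
    interpret bounded_linear "S t" by (rule bounded_linear_op) fact
    have "x - y = 0"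
      by (rule kernel_trivial[OF that]) (use xy in \<open>auto simp: Ker_def Q.diff diff\<close>)
    then show "x = y" by simp
  qed
  have bij: "bij_betw (S t) Ker Ker" if t: "t \<ge> 0" for t
  proof -
    have "S t x \<in> Ker" if "x \<in> Ker" for x
      using that t bounded_linear_op[OF t] by (simp add: Ker_def Q_S linear_simps)
    moreover have "x \<in> S t ` Ker" if "x \<in> Ker" for x
      using backward[OF t that] by blast
    ultimately show ?thesis using inj[OF t] by (auto simp: bij_betw_def)
  qed
  have unstable: "norm (inv_into Ker (S t) x) \<le> N * exp (- \<beta> * t) * norm x" if t: "t \<ge> 0" and x: "x \<in> Ker" for t x
    using backward[OF t x] inv_into_f_f[OF inj[OF t]] by metis
  show ?thesis
    unfolding exponential_dichotomy_def Let_def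
    using Q_op idem N \<beta> Q_S bij stable unstable unfolding Ker_def
    by (intro exI[of _ Q] exI[of _ N] exI[of _ \<beta>]) auto
qed

section \<open>Persistence of exponential dichotomies\<close>

text \<open>
  The order of the choices matters. The projection \<open>P\<close> of the given dichotomy fixes the smallness
  \<open>\<epsilon>\<close>; then \<open>\<tau>\<close> is taken so large that \<open>T \<tau>\<close> contracts the stable part, and its inverse the unstable part, by
  \<open>\<epsilon>\<close>; last, \<open>\<delta>\<close> is taken so small that \<open>S \<tau>\<close> lies within \<open>\<epsilon>\<close> of \<open>T \<tau>\<close>.
\<close>

theorem theorem3p7:
  fixes smul :: "'k::real_normed_field \<Rightarrow> 'a::banach \<Rightarrow> 'a"
    and T :: "real \<Rightarrow> 'a \<Rightarrow> 'a"
    and DA :: "'a set" and A :: "'a \<Rightarrow> 'a"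
  assumes "banach_over smul"
    and "C0_semigroup smul T"
    and "generator_of T DA A"
    and "exponential_dichotomy smul T"
  shows "\<exists>\<delta>::real. \<delta> > 0 \<and>
    (\<forall>(DB :: 'a set) (B :: 'a \<Rightarrow> 'a) (S :: real \<Rightarrow> 'a \<Rightarrow> 'a).
       C0_semigroup smul S \<and> generator_of S DB B \<and> yosida_distance DA A DB B < ereal \<delta>
         \<longrightarrow> exponential_dichotomy smul S)"
proof -
  interpret strongly_continuous_semigroup T by (rule C0_semigroup_strongly_continuous) fact
  obtain M \<omega> where M: "M \<ge> 1" "\<omega> \<ge> 0" "\<And>t x. t \<ge> 0 \<Longrightarrow> norm (T t x) \<le> M * exp (\<omega> * t) * norm x"
    using growth_bound_exists by blast
  then have T: "growth_bounded_semigroup T M \<omega>" by unfold_locales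
  define dichotomy_estimates where "dichotomy_estimates P N \<beta> \<longleftrightarrow> (\<forall>t\<ge>0. \<forall>x. T t (P x) = P (T t x)) \<and>
      (\<forall>t\<ge>0. bij_betw (T t) {x. P x = 0} {x. P x = 0}) \<and>
      (\<forall>t\<ge>0. \<forall>x\<in>range P. norm (T t x) \<le> N * exp (- \<beta> * t) * norm x) \<and>
      (\<forall>t\<ge>0. \<forall>x\<in>{x. P x = 0}. norm (inv_into {x. P x = 0} (T t) x) \<le> N * exp (- \<beta> * t) * norm x)"
    for P N \<beta>
  have "\<exists>P N \<beta>. bounded_operator smul P \<and> (\<forall>x. P (P x) = P x) \<and> 0 < N \<and> 0 < \<beta> \<and> dichotomy_estimates P N \<beta>"
    using assms(4) unfolding exponential_dichotomy_def Let_def dichotomy_estimates_def .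
  then obtain P N \<beta> where P_op: "bounded_operator smul P" and idem: "\<And>x. P (P x) = P x"
    and pos: "0 < N" "0 < \<beta>" and dichotomy_estimates: "dichotomy_estimates P N \<beta>"
    by blast
  have comm: "T t (P x) = P (T t x)" if "t \<ge> 0" for t x
    using dichotomy_estimates that unfolding dichotomy_estimates_def by blast
  have bij: "bij_betw (T t) {x. P x = 0} {x. P x = 0}" if "t \<ge> 0" for t
    using dichotomy_estimates that unfolding dichotomy_estimates_def by blast
  have stable: "norm (T t x) \<le> N * exp (- \<beta> * t) * norm x" if "t \<ge> 0" "x \<in> range P" for t x
    using dichotomy_estimates that unfolding dichotomy_estimates_def by blast
  have unstable: "norm (inv_into {x. P x = 0} (T t) x) \<le> N * exp (- \<beta> * t) * norm x"
    if "t \<ge> 0" "x \<in> {x. P x = 0}" for t x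
    using dichotomy_estimates that unfolding dichotomy_estimates_def by blast
  interpret P: bounded_linear P using P_op by (simp add: bounded_operator_def)
  obtain p where p: "p \<ge> 0" "\<And>x. norm (P x) \<le> norm x * p"
    using P.nonneg_bounded by blast
  \<comment> \<open>The projections onto the stable and unstable parts have norm at most \<open>p\<close> and \<open>1 + p\<close>. Thus \<open>\<epsilon>\<close> bounds
    each of the norms of \<open>P L\<close>, \<open>W\<close> and \<open>P (L' - L)\<close> below by \<open>1/12\<close>, half of the admissible \<open>1/6\<close>.\<close>
  define \<epsilon> where "\<epsilon> = 1 / (12 * (1 + p))"
  have \<epsilon>: "\<epsilon> > 0" "\<epsilon> \<le> 1" "p * \<epsilon> \<le> 1 / 12" using p(1) by (auto simp: \<epsilon>_def field_simps)

  have "((\<lambda>t. exp (- \<beta> * t)) \<longlongrightarrow> 0) at_top"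
    using pos by (intro filterlim_compose[OF exp_at_bot]
        filterlim_tendsto_neg_mult_at_bot[OF tendsto_const _ filterlim_ident]) auto
  then have "((\<lambda>t. N * exp (- \<beta> * t)) \<longlongrightarrow> 0) at_top" by (rule tendsto_mult_right_zero)
  then have "\<forall>\<^sub>F t in at_top. N * exp (- \<beta> * t) < \<epsilon>" using \<epsilon>(1) by (rule order_tendstoD)
  then have ev: "\<forall>\<^sub>F t in at_top. 0 < t \<and> N * exp (- \<beta> * t) < \<epsilon>"
    using eventually_gt_at_top[of 0] by eventually_elim simp
  obtain \<tau> where \<tau>: "\<tau> > 0" and small: "N * exp (- \<beta> * \<tau>) < \<epsilon>"
    using eventually_happens'[OF trivial_limit_at_top_linorder ev] by blast

  define L where "L = T \<tau>"
  define Ker where "Ker = {x. P x = 0}"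
  define W where "W x = inv_into Ker L (x - P x)" for x
  interpret L: bounded_linear L unfolding L_def by (rule bounded_linear_op) (use \<tau> in simp)
  have bijL: "bij_betw L Ker Ker" unfolding L_def Ker_def by (rule bij) (use \<tau> in simp)
  then have injL: "inj_on L Ker" by (simp add: bij_betw_def)
  have compl: "x - P x \<in> Ker" for x by (simp add: Ker_def P.diff idem)
  have W_Ker: "W x \<in> Ker" for x
    unfolding W_def using compl bijL by (metis bij_betw_def inv_into_into)
  have LW: "L (W x) = x - P x" for x
    unfolding W_def using compl bijL by (metis bij_betw_inv_into_right)
  have commL: "L (P x) = P (L x)" for x unfolding L_def by (rule comm) (use \<tau> in simp)
  have WL: "W (L x) = x - P x" for x
    using inv_into_f_f[OF injL compl[of x]] by (simp add: W_def L.diff commL)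
  have W_eqI: "W x = y" if "y \<in> Ker" "L y = x - P x" for x y
    using that inv_into_f_f[OF injL] by (metis W_def)
  have W_bound: "norm (W x) \<le> norm x / 12" for x
  proof -
    have "norm (W x) \<le> N * exp (- \<beta> * \<tau>) * norm (x - P x)"
      unfolding W_def L_def Ker_def by (rule unstable) (use \<tau> compl in \<open>auto simp: Ker_def\<close>)
    also have "\<dots> \<le> \<epsilon> * (norm x + norm x * p)"
      using small \<epsilon>(1) p(2)[of x] norm_triangle_ineq4[of x "P x"] by (intro mult_mono) auto
    also have "\<dots> = norm x / 12" using p(1) by (simp add: \<epsilon>_def field_simps)
    finally show ?thesis .
  qed
  have W_lin: "bounded_linear W"
  proof (rule bounded_linear_intro)
    have ker: "W x + W y \<in> Ker" "r *\<^sub>R W x \<in> Ker" for x y r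
      using W_Ker by (auto simp: Ker_def P.add P.scaleR)
    show "W (x + y) = W x + W y" for x y
      by (rule W_eqI[OF ker(1)]) (simp add: L.add LW P.add algebra_simps)
    show "W (r *\<^sub>R x) = r *\<^sub>R W x" for r x
      by (rule W_eqI[OF ker(2)]) (simp add: L.scaleR LW P.scaleR algebra_simps)
    show "norm (W x) \<le> norm x * (1 / 12)" for x using W_bound[of x] by simp
  qed

  \<comment> \<open>For \<open>\<delta> \<le> 1\<close> the distance of \<open>S \<tau>\<close> and \<open>T \<tau>\<close> is at most \<open>E * \<delta>\<close>.\<close>
  define E where "E = M\<^sup>2 * \<tau> * exp ((2 * \<omega> + M) * \<tau>)"
  have E: "E > 0" using M(1) \<tau> by (simp add: E_def)
  define \<delta> where "\<delta> = min 1 (\<epsilon> / E)"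
  have \<delta>: "\<delta> > 0" "\<delta> \<le> 1" "E * \<delta> \<le> \<epsilon>"
    using E \<epsilon>(1) by (auto simp: \<delta>_def min_def field_simps)
  have main: "exponential_dichotomy smul S"
    if S: "C0_semigroup smul S" and B: "generator_of S DB B" and dist: "yosida_distance DA A DB B < ereal \<delta>"
    for DB B S
  proof -
    interpret S: strongly_continuous_semigroup S by (rule C0_semigroup_strongly_continuous[OF S])
    define L' where "L' = S \<tau>"
    have L'_lin: "bounded_linear L'" unfolding L'_def by (rule S.bounded_linear_op) (use \<tau> in simp)
    have close: "norm (L' x - L x) \<le> \<epsilon> * norm x" for x
    proof -
      have "norm (L' x - L x) \<le> M\<^sup>2 * (\<delta> * \<tau>) * exp ((2 * \<omega> + M * \<delta>) * \<tau>) * norm x"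
        unfolding L'_def L_def
        by (rule semigroup_distance_le[OF T S.strongly_continuous_semigroup_axioms assms(3) B dist])
          (use \<delta> \<tau> in auto)
      also have "exp ((2 * \<omega> + M * \<delta>) * \<tau>) \<le> exp ((2 * \<omega> + M) * \<tau>)"
        using \<delta> \<tau> M(1) by (simp add: mult_right_mono mult_left_le)
      then have "M\<^sup>2 * (\<delta> * \<tau>) * exp ((2 * \<omega> + M * \<delta>) * \<tau>) * norm x \<le> E * \<delta> * norm x"
        using \<delta> \<tau> by (auto simp: E_def mult_ac intro!: mult_left_mono)
      also have "\<dots> \<le> \<epsilon> * norm x" using \<delta>(3) by (rule mult_right_mono) simp
      finally show ?thesis .
    qed
    have "has_decaying_responses L'"
    proof (rule has_decaying_responses_perturbation[OF L.bounded_linear_axioms L'_lin P.bounded_linear_axioms W_lin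
          idem commL _ LW WL])
      show "P (W x) = 0" for x using W_Ker[of x] by (simp add: Ker_def)
      show "norm (P (L' x)) \<le> norm x / 6" for x
      proof -
        have "norm (P (L x)) \<le> norm x / 12"
        proof -
          have "norm (P (L x)) \<le> N * exp (- \<beta> * \<tau>) * norm (P x)"
            unfolding commL[symmetric] unfolding L_def by (rule stable) (use \<tau> in auto)
          also have "\<dots> \<le> \<epsilon> * (norm x * p)"
            using small \<epsilon>(1) p(2)[of x] by (intro mult_mono) auto
          also have "\<dots> \<le> norm x / 12"
            using mult_right_mono[OF \<epsilon>(3) norm_ge_zero[of x]] by (simp add: mult_ac)
          finally show ?thesis .
        qed
        moreover have "norm (P (L' x - L x)) \<le> norm x / 12"
        proof -
          have "norm (P (L' x - L x)) \<le> \<epsilon> * norm x * p"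
            using p(2)[of "L' x - L x"] mult_right_mono[OF close p(1), of x] by simp
          also have "\<dots> \<le> norm x / 12"
            using mult_right_mono[OF \<epsilon>(3) norm_ge_zero[of x]] by (simp add: mult_ac)
          finally show ?thesis .
        qed
        ultimately show ?thesis
          using norm_triangle_ineq[of "P (L x)" "P (L' x - L x)"] by (simp add: P.diff)
      qed
      show "norm (W x) \<le> norm x / 6" for x
        using W_bound[of x] norm_ge_zero[of x] by linarith
      show "norm (W (L' x - L x)) \<le> norm x / 6" for x
      proof -
        have "\<epsilon> * norm x \<le> norm x" using \<epsilon> by (simp add: mult_left_le_one_le)
        then show ?thesis
          using W_bound[of "L' x - L x"] close[of x] norm_ge_zero[of x] by linarith
      qed
    qed
    then show ?thesis
      unfolding L'_def by (rule exponential_dichotomy_of_responses[OF assms(1) S \<tau>])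
  qed
  show ?thesis
  proof (intro exI[of _ \<delta>] conjI allI impI)
    show "\<delta> > 0" by (rule \<delta>(1))
  qed (use main in blast)
qed

end
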